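(* Suppose that $\tau$ is recurrent, i.e. $\mathbf{P}(\tau_1<\infty)=1$, and that $\mathbf{P}(\tau_1=n)=\varphi(n)\,n^{-1}$ for all integers $n\ge 1$, where $\varphi$ is a positive slowly varying function. Then, uniformly for $k$ such that $k\varphi(n)\to 0$, we have $$\mathbf{P}(\tau_k=n)\sim k\,\mathbf{P}(\tau_1=n)\,(1-r_n)^k\qquad\text{as } n\to\infty;$$ that is, for every sequence of integers $k=k_n\ge 1$ with $k_n\varphi(n)\to 0$ as $n\to\infty$, the ratio of the two sides (with $k=k_n$) tends to $1$ as $n\to\infty$. Further, there exists a constant $c_1>0$ (depending only on the distribution of $\tau_1$) such that for all sufficiently large $n$ and all integers $1\le k\le n$, $$\mathbf{P}(\tau_k=n)\le c_1\,k\,\mathbf{P}(\tau_1=n)\,(1-r_n)^k.$$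
   Context: $\tau=\{0=\tau_0,\tau_1,\tau_2,\dots\}$ is a renewal process: the increments $\tau_i-\tau_{i-1}$, $i\ge1$, are i.i.d. with values in $\{1,2,3,\dots\}$, so $\tau_k$ is the sum of $k$ i.i.d. copies of $\tau_1$. Notation: $r_n:=r(n):=\mathbf{P}(\tau_1>n)$. A positive function $\varphi$ is slowly varying if $\varphi(\lambda x)/\varphi(x)\to1$ as $x\to\infty$ for every $\lambda>0$; $\varphi$ given on the positive integers is regarded as a function on $[1,\infty)$ via, e.g., $\varphi(x)=\varphi(\lfloor x\rfloor)$. *)

theory Defs
  imports "HOL-Probability.Probability" "HOL-Library.Extended_Nat"
begin

text \<open>
  The increments take values in \<open>{1, 2, 3, \<dots>} \<union> {\<infinity>}\<close>, so that recurrence, i.e.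
  \<open>\<P>(\<tau>\<^sub>1 < \<infinity>) = 1\<close>, is a genuine property of a renewal process. The increments are
  existentially quantified since they cannot be recovered as differences once \<open>\<tau>\<close> is infinite.
\<close>

definition renewal_process :: "'a measure \<Rightarrow> (nat \<Rightarrow> 'a \<Rightarrow> enat) \<Rightarrow> bool" where
  "renewal_process M \<tau> \<longleftrightarrow>
     prob_space M \<and>
     (\<exists>\<xi> :: nat \<Rightarrow> 'a \<Rightarrow> enat.
        prob_space.indep_vars M (\<lambda>_. count_space UNIV) \<xi> UNIV \<and>
        (\<forall>i. distr M (count_space UNIV) (\<xi> i) = distr M (count_space UNIV) (\<xi> 0)) \<and>
        (\<forall>i. \<forall>\<omega>\<in>space M. \<xi> i \<omega> \<ge> 1) \<and>
        (\<forall>k. \<forall>\<omega>\<in>space M. \<tau> k \<omega> = (\<Sum>i<k. \<xi> i \<omega>)))"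

definition recurrent :: "'a measure \<Rightarrow> (nat \<Rightarrow> 'a \<Rightarrow> enat) \<Rightarrow> bool" where
  "recurrent M \<tau> \<longleftrightarrow> \<P>(\<omega> in M. \<tau> 1 \<omega> < \<infinity>) = 1"

definition renewal_tail :: "'a measure \<Rightarrow> (nat \<Rightarrow> 'a \<Rightarrow> enat) \<Rightarrow> nat \<Rightarrow> real" where
  "renewal_tail M \<tau> n = \<P>(\<omega> in M. \<tau> 1 \<omega> > enat n)"

text \<open>Positivity is not part of this definition; it is required separately.\<close>

definition slowly_varying :: "(real \<Rightarrow> real) \<Rightarrow> bool" where
  "slowly_varying f \<longleftrightarrow> (\<forall>c>0. ((\<lambda>x. f (c * x) / f x) \<longlongrightarrow> 1) at_top)"

end

theory Submission
  imports Defs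
begin

text \<open>
  The proof is the principle of the single big jump. A walk of \<open>k\<close> steps reaches \<open>n\<close> mainly
  by one jump of size close to \<open>n\<close>, while the other \<open>k - 1\<close> steps together stay far below \<open>n\<close>. There
  are \<open>k\<close> positions for the big jump, it has weight about \<open>p n = \<phi> n / n\<close>, and the other
  steps are merely known not to exceed \<open>n\<close>, which has probability \<open>F n ^ (k - 1)\<close> with
  \<open>F n = 1 - r n \<longlongrightarrow> 1\<close>. This accounts for \<open>k * p n * F n ^ k\<close>.

  The difficulty is that \<open>F n ^ k\<close> can be very small in the admissible range of \<open>k\<close>,
  so all other contributions have to be estimated relative to it. Slow variation helps twice.
  The first moment of a jump truncated at \<open>y\<close> is only \<open>O(y * \<phi> y)\<close> (\<open>karamata_bound\<close>), so
  tilting the jumps up to \<open>y\<close> by \<open>exp (m / y)\<close> adds only \<open>O(\<phi> y)\<close> to the mass. On the other hand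
  each doubling of the truncation level adds mass of order \<open>\<phi> y\<close>. Hence the tilted mass of the
  jumps up to \<open>y\<close> is at most \<open>F (K * y)\<close> for a constant \<open>K\<close>
  (\<open>truncated_exponential_moment\<close>): for \<open>n \<ge> K * y\<close>, walks with jumps up to \<open>y\<close> reach \<open>a\<close> with
  weight at most \<open>exp (- a / y) * F n ^ k\<close>, and nothing of the factor \<open>F n ^ k\<close> is lost.

  A decomposition according to the dyadic block of the largest jump then shows that walks
  without a jump of order \<open>n\<close> are negligible, uniformly in \<open>k\<close>
  (\<open>small_jumps_negligible\<close>). Bounding jumps of order \<open>n\<close> crudely gives the uniform upper bound
  (\<open>uniform_local_bound\<close>). For the asymptotics (\<open>local_asymptotics\<close>), Markov's inequality shows
  that the remaining steps cover a positive fraction of \<open>n\<close> only with relative weight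
  \<open>O(k * \<phi> n)\<close>, which tends to \<open>0\<close> by assumption; so the big jump is close to \<open>n\<close>, where \<open>p\<close> is nearly
  \<open>p n\<close>.

  Walks with jumps up to \<open>y\<close> are counted by the coefficients of powers of the polynomial
  \<open>jump_gf y = (\<Sum>m\<le>y. p m * X ^ m)\<close>. The union bound over the position of the big jump
  becomes the factorisation of \<open>A ^ k - B ^ k\<close> (\<open>coeff_power_diff_bounds\<close>), and exponential and
  first moments become values of the polynomials and of their derivatives.
\<close>

section \<open>Uniform convergence of slowly varying sequences\<close>

text \<open>
  A Steinhaus-type argument. Suppose \<open>h (x + u) - h x\<close> fails to be small along pairs
  \<open>(x n, u n)\<close>. For late \<open>n\<close>, the increments \<open>h (x n + v) - h (x n)\<close> are small for more than
  three quarters of all \<open>v \<in> [0, 2A]\<close>, and so are the increments from \<open>x n + u n\<close>. Shifted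
  by \<open>u n\<close>, the second set still lies in \<open>[0, 3A]\<close>; two sets of measure above \<open>3A/2\<close> in an
  interval of length \<open>3A\<close> meet, and a common point links \<open>x n\<close> with \<open>x n + u n\<close> by two small
  increments.
\<close>

lemma uniform_convergence_additive:
  fixes h :: "real \<Rightarrow> real"
  assumes meas: "h \<in> borel_measurable borel"
    and lim: "\<And>u. ((\<lambda>x. h (x + u) - h x) \<longlongrightarrow> 0) at_top"
    and "A > 0" "e > 0"
  shows "\<forall>\<^sub>F x in at_top. \<forall>u\<in>{0..A}. \<bar>h (x + u) - h x\<bar> < e"
proof (rule ccontr)
  assume "\<not> ?thesis"
  then have fr: "\<forall>X. \<exists>x\<ge>X. \<exists>u\<in>{0..A}. e \<le> \<bar>h (x + u) - h x\<bar>"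
    by (auto simp: eventually_at_top_linorder not_less)
  then have "\<forall>n. \<exists>xu. fst xu \<ge> real n \<and> snd xu \<in> {0..A} \<and> e \<le> \<bar>h (fst xu + snd xu) - h (fst xu)\<bar>"
    by force
  then obtain xu where xu: "\<And>n. fst (xu n) \<ge> real n" "\<And>n. snd (xu n) \<in> {0..A}"
    "\<And>n. e \<le> \<bar>h (fst (xu n) + snd (xu n)) - h (fst (xu n))\<bar>"
    by metis
  define x where "x n = fst (xu n)" for n
  define u where "u n = snd (xu n)" for n
  have x: "x n \<ge> real n" and u: "0 \<le> u n" "u n \<le> A" and bad: "e \<le> \<bar>h (x n + u n) - h (x n)\<bar>" for n
    using xu[of n] by (auto simp: x_def u_def)
  define G where "G z n = {v\<in>{0..2*A}. \<forall>m\<ge>n. \<bar>h (z m + v) - h (z m)\<bar> < e/2}" for z :: "nat \<Rightarrow> real" and n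
  have G_sets: "G z n \<in> sets borel" for z n
    using meas unfolding G_def by measurable
  have large: "\<exists>N. \<forall>n\<ge>N. measure lborel (G z n) > 3/2*A" if z: "\<And>n. z n \<ge> real n" for z
  proof -
    have ztop: "filterlim z at_top sequentially"
      using z by (intro filterlim_at_top_mono[OF filterlim_real_sequentially]) auto
    have un: "(\<Union>n. G z n) = {0..2*A}"
    proof (intro equalityI subsetI)
      fix v assume v: "v \<in> {0..2*A}"
      have "(\<lambda>n. h (z n + v) - h (z n)) \<longlonglongrightarrow> 0"
        using filterlim_compose[OF lim ztop, of v] by simp
      then have "\<forall>\<^sub>F n in sequentially. dist (h (z n + v) - h (z n)) 0 < e/2"
        using \<open>e > 0\<close> by (intro tendstoD) auto
      then show "v \<in> (\<Union>n. G z n)"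
        using v by (auto simp: G_def eventually_sequentially dist_real_def)
    qed (auto simp: G_def)
    have inc: "incseq (G z)"
      by (auto simp: incseq_def G_def)
    have "(\<lambda>n. measure lborel (G z n)) \<longlonglongrightarrow> measure lborel (\<Union>n. G z n)"
      using inc un \<open>A > 0\<close> G_sets by (intro Lim_measure_incseq) (auto simp: un)
    then have "(\<lambda>n. measure lborel (G z n)) \<longlonglongrightarrow> 2*A"
      using un \<open>A > 0\<close> by simp
    from order_tendstoD(1)[OF this, of "3/2*A"] \<open>A > 0\<close> show ?thesis
      by (auto simp: eventually_sequentially)
  qed
  obtain N1 where N1: "\<And>n. n \<ge> N1 \<Longrightarrow> measure lborel (G x n) > 3/2*A"
    using large[of x] x by blast
  have "x n + u n \<ge> real n" for n using x[of n] u[of n] by linarith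
  then obtain N2 where N2: "\<And>n. n \<ge> N2 \<Longrightarrow> measure lborel (G (\<lambda>n. x n + u n) n) > 3/2*A"
    using large[of "\<lambda>n. x n + u n"] by blast
  define N where "N = max N1 N2"
  define V where "V = G x N"
  define W where "W = G (\<lambda>n. x n + u n) N"
  define W' where "W' = (+) (u N) ` W"
  have GL: "G z n \<in> lmeasurable" for z n
  proof (rule fmeasurableI2)
    show "G z n \<subseteq> {0..2*A}" by (auto simp: G_def)
    show "G z n \<in> sets lebesgue" using G_sets[of z n] by (simp add: sets_completionI_sets)
  qed simp
  have VL: "V \<in> lmeasurable" and WL: "W' \<in> lmeasurable"
    by (simp_all add: V_def W'_def W_def GL measurable_translation)
  have "measure lebesgue V > 3/2*A" "measure lebesgue W > 3/2*A"
    using N1[of N] N2[of N] G_sets by (simp_all add: V_def W_def N_def)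
  then have "measure lebesgue V + measure lebesgue W' > 3*A"
    by (simp add: W'_def measure_translation)
  moreover have "measure lebesgue (V \<union> W') \<le> measure lebesgue {0..3*A}"
  proof (rule measure_mono_fmeasurable)
    have "V \<subseteq> {0..2*A}" "W \<subseteq> {0..2*A}" by (auto simp: V_def W_def G_def)
    then show "V \<union> W' \<subseteq> {0..3*A}" using u[of N] by (fastforce simp: W'_def)
    show "V \<union> W' \<in> sets lebesgue" using VL WL by (intro sets.Un fmeasurableD)
  qed simp
  moreover have "measure lebesgue {0..3*A} = 3*A" using \<open>A > 0\<close> by simp
  ultimately have "\<not> disjnt V W'"
    using measure_Un2[OF VL WL] WL by (auto simp: disjnt_def Diff_triv Int_commute)
  then obtain w where w: "w \<in> W" "u N + w \<in> V" by (auto simp: W'_def disjnt_iff)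
  have "\<bar>h (x N + (u N + w)) - h (x N)\<bar> < e/2" "\<bar>h (x N + u N + w) - h (x N + u N)\<bar> < e/2"
    using w by (auto simp: V_def W_def G_def)
  with bad[of N] show False unfolding add.assoc by linarith
qed

text \<open>
  Division by zero gives the summand \<open>n = 0\<close> the value \<open>0\<close>, so the series below is the total
  mass of a law on the positive integers and the recurrence of the walk is the value \<open>1\<close> of
  its sum.
\<close>

locale slowly_varying_jumps =
  fixes \<phi> :: "nat \<Rightarrow> real"
  assumes \<phi>_pos: "n \<ge> 1 \<Longrightarrow> \<phi> n > 0"
    and slowly_varying: "slowly_varying (\<lambda>x. \<phi> (nat \<lfloor>x\<rfloor>))"
    and total_mass: "(\<lambda>n. \<phi> n / real n) sums 1"
begin

text \<open>
  In logarithmic coordinates slow variation becomes the hypothesis of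
  \<open>uniform_convergence_additive\<close> for \<open>h x = ln (\<phi> \<lfloor>exp x\<rfloor>)\<close>. Integers are hit exactly, at
  \<open>x = ln n\<close>, so rounding costs nothing on the way back.
\<close>

lemma uniform_convergence:
  assumes "e > 0"
  shows "\<forall>\<^sub>F n in sequentially. \<forall>m\<in>{n..K*n}. \<bar>\<phi> m / \<phi> n - 1\<bar> < e"
proof -
  define h where "h x = ln (\<phi> (nat \<lfloor>exp x\<rfloor>))" for x :: real
  have meas: "h \<in> borel_measurable borel"
  proof -
    have floor_exp: "(\<lambda>x::real. \<lfloor>exp x\<rfloor>) \<in> borel \<rightarrow>\<^sub>M count_space UNIV"
      by (rule measurable_compose[OF _ measurable_real_floor]) measurable
    have "(\<lambda>i. ln (\<phi> (nat i))) \<in> count_space UNIV \<rightarrow>\<^sub>M borel" by simp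
    from measurable_compose[OF floor_exp this] show ?thesis
      by (simp add: h_def[abs_def])
  qed
  have lim: "((\<lambda>x. h (x + u) - h x) \<longlongrightarrow> 0) at_top" for u
  proof -
    have "((\<lambda>x. \<phi> (nat \<lfloor>exp u * exp x\<rfloor>) / \<phi> (nat \<lfloor>exp x\<rfloor>)) \<longlongrightarrow> 1) at_top"
    proof (rule filterlim_compose[OF _ exp_at_top])
      show "((\<lambda>x. \<phi> (nat \<lfloor>exp u * x\<rfloor>) / \<phi> (nat \<lfloor>x\<rfloor>)) \<longlongrightarrow> 1) at_top"
        using slowly_varying unfolding slowly_varying_def by simp
    qed
    then have "((\<lambda>x. ln (\<phi> (nat \<lfloor>exp u * exp x\<rfloor>) / \<phi> (nat \<lfloor>exp x\<rfloor>))) \<longlongrightarrow> ln 1) at_top"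
      by (intro tendsto_ln) auto
    moreover have "\<forall>\<^sub>F x in at_top. ln (\<phi> (nat \<lfloor>exp u * exp x\<rfloor>) / \<phi> (nat \<lfloor>exp x\<rfloor>)) = h (x + u) - h x"
      using eventually_ge_at_top[of "max 0 (-u)"]
    proof eventually_elim
      case (elim x)
      then have "1 \<le> exp x" "1 \<le> exp (x + u)" by auto
      then have "nat \<lfloor>exp x\<rfloor> \<ge> 1" "nat \<lfloor>exp (x + u)\<rfloor> \<ge> 1"
        by (simp_all add: le_nat_floor)
      from this[THEN \<phi>_pos] show ?case
        by (simp add: h_def ln_div exp_add mult.commute)
    qed
    ultimately show ?thesis using Lim_transform_eventually by fastforce
  qed
  define d where "d = min (1/2) (e/2)"
  have d: "0 < d" "d \<le> 1/2" "2*d \<le> e" using \<open>e > 0\<close> by (auto simp: d_def)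
  have "\<forall>\<^sub>F x in at_top. \<forall>u\<in>{0..ln (real K + 2)}. \<bar>h (x + u) - h x\<bar> < d/2"
    using d by (intro uniform_convergence_additive meas lim) auto
  then have "\<forall>\<^sub>F n in sequentially. \<forall>u\<in>{0..ln (real K + 2)}. \<bar>h (ln (real n) + u) - h (ln (real n))\<bar> < d/2"
    by (rule eventually_compose_filterlim)
       (rule filterlim_compose[OF ln_at_top filterlim_real_sequentially])
  then show ?thesis
    using eventually_gt_at_top[of 0]
  proof eventually_elim
    case (elim n)
    show ?case
    proof
      fix m assume m: "m \<in> {n..K*n}"
      with elim have "m > 0" by auto
      have u: "ln (real m) - ln (real n) \<in> {0..ln (real K + 2)}"
      proof -
        have "real m \<le> real (K * n)" using m by (simp only: of_nat_le_iff) simp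
        also have "\<dots> \<le> (real K + 2) * real n" by (simp add: algebra_simps)
        finally have "ln (real m) \<le> ln ((real K + 2) * real n)"
          using \<open>m > 0\<close> elim by (subst ln_le_cancel_iff) auto
        with m elim \<open>m > 0\<close> show ?thesis by (auto simp: ln_mult)
      qed
      have "h (ln (real j)) = ln (\<phi> j)" if "j > 0" for j
        using that by (simp add: h_def[abs_def])
      with bspec[OF elim(1) u] \<open>m > 0\<close> elim(2) have "\<bar>ln (\<phi> m) - ln (\<phi> n)\<bar> < d/2"
        by simp
      then have t: "\<bar>ln (\<phi> m / \<phi> n)\<bar> < d/2"
        using \<phi>_pos[of m] \<phi>_pos[of n] \<open>m > 0\<close> elim(2) by (simp add: ln_div)
      have pos: "\<phi> m / \<phi> n > 0" using \<phi>_pos[of m] \<phi>_pos[of n] \<open>m > 0\<close> elim(2) by simp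
      have lb: "\<phi> m / \<phi> n \<ge> 1 - d/2"
        using exp_ge_add_one_self[of "ln (\<phi> m / \<phi> n)"] t unfolding exp_ln[OF pos] by linarith
      have "\<phi> m / \<phi> n = exp (ln (\<phi> m / \<phi> n))" using pos by simp
      also have "\<dots> \<le> exp (d/2)" using t by (subst exp_le_cancel_iff) linarith
      also have "\<dots> \<le> 1 + 2 * (d/2)" using d by (intro real_exp_bound_lemma) auto
      finally show "\<bar>\<phi> m / \<phi> n - 1\<bar> < e" using lb d by linarith
    qed
  qed
qed

section \<open>Potter and Karamata bounds\<close>

definition p :: "nat \<Rightarrow> real" where "p m = \<phi> m / real m"

lemma p_0 [simp]: "p 0 = 0" by (simp add: p_def)

lemma p_pos: "m \<ge> 1 \<Longrightarrow> p m > 0"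
  using \<phi>_pos[of m] by (simp add: p_def)

lemma p_nonneg [simp]: "p m \<ge> 0"
  using p_pos[of m] by (cases "m = 0") auto

lemma p_sums: "p sums 1"
  using total_mass by (simp add: p_def[abs_def])

lemma \<phi>_comparable:
  assumes "c > 1"
  obtains N where "N \<ge> 1"
    "\<And>m n. N \<le> m \<Longrightarrow> m \<le> n \<Longrightarrow> n \<le> K * m \<Longrightarrow> \<phi> m \<le> c * \<phi> n"
    "\<And>m n. N \<le> m \<Longrightarrow> m \<le> n \<Longrightarrow> n \<le> K * m \<Longrightarrow> \<phi> n \<le> c * \<phi> m"
proof -
  have "\<forall>\<^sub>F n in sequentially. \<forall>m\<in>{n..K*n}. \<bar>\<phi> m / \<phi> n - 1\<bar> < 1 - 1/c"
    using assms by (intro uniform_convergence) simp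
  then obtain N where N: "\<And>n m. n \<ge> N \<Longrightarrow> m \<in> {n..K*n} \<Longrightarrow> \<bar>\<phi> m / \<phi> n - 1\<bar> < 1 - 1/c"
    unfolding eventually_sequentially by blast
  have "\<phi> m \<le> c * \<phi> n \<and> \<phi> n \<le> c * \<phi> m" if mn: "max N 1 \<le> m" "m \<le> n" "n \<le> K * m" for m n
  proof -
    have "\<bar>\<phi> n / \<phi> m - 1\<bar> < 1 - 1/c" using N[of m n] mn by simp
    then have quot: "1/c \<le> \<phi> n / \<phi> m" "\<phi> n / \<phi> m \<le> 2 - 1/c" by linarith+
    have "0 \<le> (c - 1)\<^sup>2 / c" using assms by simp
    also have "(c - 1)\<^sup>2 / c = c - (2 - 1/c)"
      using assms by (simp add: power2_eq_square field_simps)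
    finally have "\<phi> n / \<phi> m \<le> c" using quot(2) by linarith
    with quot(1) show ?thesis
      using assms \<phi>_pos[of m] mn by (simp add: field_simps)
  qed
  then show thesis by (intro that[of "max N 1"]) auto
qed

text \<open>
  Halving \<open>n\<close> changes \<open>\<phi> n\<close> by a factor close to \<open>1\<close>. Any factor below \<open>2\<close> is enough for the
  induction, because the power \<open>n / j\<close> absorbs a factor of almost \<open>2\<close> at every halving.
\<close>

lemma potter_bound:
  obtains y where "y \<ge> 1" "\<And>j n. y \<le> j \<Longrightarrow> j \<le> n \<Longrightarrow> \<phi> j \<le> 2 * (real n / real j) * \<phi> n"
proof -
  obtain N where N: "N \<ge> 1" "\<And>m n. N \<le> m \<Longrightarrow> m \<le> n \<Longrightarrow> n \<le> 2 * m \<Longrightarrow> \<phi> m \<le> 3/2 * \<phi> n"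
    by (rule \<phi>_comparable[of "3/2" 2]) auto
  have "\<phi> j \<le> 2 * (real n / real j) * \<phi> n" if "N \<le> j" "j \<le> n" for j n
    using that
  proof (induction n rule: less_induct)
    case (less n)
    have [simp]: "j > 0" "n > 0" "\<phi> n \<ge> 0" using less.prems N(1) \<phi>_pos[of n] by auto
    show ?case
    proof (cases "n \<le> 2 * j")
      case True
      then have "\<phi> j \<le> 3/2 * \<phi> n" using N(2)[of j n] less.prems by auto
      also have "\<dots> \<le> 2 * (real n / real j) * \<phi> n"
        using less.prems by (intro mult_right_mono) (auto simp: field_simps)
      finally show ?thesis .
    next
      case False
      define h where "h = (n + 1) div 2"
      have h: "N \<le> h" "j \<le> h" "h < n" "n \<le> 2 * h" "3 * h \<le> 2 * n"
        using False less.prems N(1) unfolding h_def by linarith+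
      then have "\<phi> j \<le> 2 * (real h / real j) * \<phi> h" using less by blast
      also have "\<dots> \<le> 2 * (real h / real j) * (3/2 * \<phi> n)"
        using h less.prems by (intro mult_left_mono N(2)) auto
      also have "\<dots> = (3/2 * real h) * (2 / real j * \<phi> n)" by simp
      also have "\<dots> \<le> real n * (2 / real j * \<phi> n)"
        using h(5) by (intro mult_right_mono) auto
      finally show ?thesis by (simp add: mult_ac)
    qed
  qed
  with N(1) that show thesis by blast
qed

text \<open>
  The sum over the lower half of \<open>{1..y}\<close> is by induction at most \<open>C * (y/2) * \<phi> (y/2)\<close>, which
  is only about half of the target, while the upper half contributes about \<open>y/2 * \<phi> y\<close>.
  The finitely many small \<open>y\<close> are absorbed into \<open>C\<close>.
\<close>

lemma karamata_bound:
  obtains C where "C > 0" "\<And>y. y \<ge> 1 \<Longrightarrow> (\<Sum>m=1..y. \<phi> m) \<le> C * real y * \<phi> y"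
proof -
  obtain N where N: "N \<ge> 1" "\<And>m n. N \<le> m \<Longrightarrow> m \<le> n \<Longrightarrow> n \<le> 3 * m \<Longrightarrow> \<phi> m \<le> 5/4 * \<phi> n"
    by (rule \<phi>_comparable[of "5/4" 3]) auto
  define T where "T y = (\<Sum>m=1..y. \<phi> m)" for y
  have T_nonneg: "T y \<ge> 0" for y
    unfolding T_def by (intro sum_nonneg) (use \<phi>_pos in \<open>force intro: less_imp_le\<close>)
  define C where "C = 4 + (\<Sum>y=1..2*N. T y / (real y * \<phi> y))"
  have C_nonneg: "T y / (real y * \<phi> y) \<ge> 0" if "y \<in> {1..2*N}" for y
    using T_nonneg \<phi>_pos[of y] that by (intro divide_nonneg_nonneg mult_nonneg_nonneg) auto
  have "C \<ge> 4" unfolding C_def using sum_nonneg[of "{1..2*N}" "\<lambda>y. T y / (real y * \<phi> y)"] C_nonneg by simp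
  have "T y \<le> C * real y * \<phi> y" if "y \<ge> 1" for y
    using that
  proof (induction y rule: less_induct)
    case (less y)
    have [simp]: "\<phi> y > 0" "\<phi> y \<ge> 0" using \<phi>_pos[of y] less.prems by auto
    show ?case
    proof (cases "y \<le> 2 * N")
      case True
      then have "T y / (real y * \<phi> y) \<le> (\<Sum>y=1..2*N. T y / (real y * \<phi> y))"
        using less.prems C_nonneg by (intro member_le_sum) auto
      then have "T y / (real y * \<phi> y) \<le> C" by (simp add: C_def)
      then show ?thesis using less.prems by (simp add: field_simps)
    next
      case False
      define h where "h = y div 2"
      have h: "N \<le> h" "h < y" "h \<le> y" "y \<le> 3 * h" "2 * h \<le> y" "1 \<le> h"
        using False N(1) unfolding h_def by linarith+
      have "T y = T h + (\<Sum>m=h+1..y. \<phi> m)"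
        unfolding T_def using h sum.ub_add_nat[of 1 h \<phi> "y - h"] by simp
      also have "(\<Sum>m=h+1..y. \<phi> m) \<le> (\<Sum>m=h+1..y. 5/4 * \<phi> y)"
        using h by (intro sum_mono N(2)) auto
      also have "\<dots> \<le> real y * (5/4 * \<phi> y)" by simp
      also have "T h \<le> C * real h * \<phi> h" using less h by auto
      also have "\<dots> \<le> C * real h * (5/4 * \<phi> y)"
        using \<open>C \<ge> 4\<close> h by (intro mult_left_mono N(2)) auto
      also have "\<dots> = real h * (C * (5/4 * \<phi> y))" by simp
      also have "\<dots> \<le> (real y / 2) * (C * (5/4 * \<phi> y))"
        using h \<open>C \<ge> 4\<close> by (intro mult_right_mono) auto
      finally have "T y \<le> (5/8 * C + 5/4) * (real y * \<phi> y)" by (simp add: algebra_simps)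
      also have "\<dots> \<le> C * (real y * \<phi> y)"
        using \<open>C \<ge> 4\<close> by (intro mult_right_mono) auto
      finally show ?thesis by simp
    qed
  qed
  with \<open>C \<ge> 4\<close> show thesis by (intro that[of C]) (auto simp: T_def)
qed

text \<open>
  For \<open>j\<close> within \<open>n / N\<close> of \<open>n\<close> both factors of \<open>p j = \<phi> j / j\<close> are close to those of \<open>p n\<close>;
  \<open>N \<ge> 1 + 1/a\<close> makes \<open>n / j\<close> at most \<open>1 + a\<close>.
\<close>

lemma p_comparable:
  assumes a: "0 < a" "a \<le> 1"
  obtains N where "N \<ge> 2"
    "\<forall>\<^sub>F n in sequentially. \<forall>j\<in>{n - n div N<..n}. (1 - a) * p n \<le> p j \<and> p j \<le> (1 + a)\<^sup>2 * p n"
proof -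
  obtain N0 where N0: "N0 \<ge> 1"
    "\<And>m n. N0 \<le> m \<Longrightarrow> m \<le> n \<Longrightarrow> n \<le> 2 * m \<Longrightarrow> \<phi> m \<le> (1 + a) * \<phi> n"
    "\<And>m n. N0 \<le> m \<Longrightarrow> m \<le> n \<Longrightarrow> n \<le> 2 * m \<Longrightarrow> \<phi> n \<le> (1 + a) * \<phi> m"
    by (rule \<phi>_comparable[of "1 + a" 2]) (use a in auto)
  define N where "N = nat \<lceil>1/a\<rceil> + 2"
  have N: "N \<ge> 2" "1/a \<le> real N - 1" unfolding N_def by linarith+
  show thesis
  proof (rule that[of N])
    show "\<forall>\<^sub>F n in sequentially. \<forall>j\<in>{n - n div N<..n}. (1 - a) * p n \<le> p j \<and> p j \<le> (1 + a)\<^sup>2 * p n"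
      using eventually_ge_at_top[of "2 * N0"]
    proof eventually_elim
      case (elim n)
      show ?case
      proof (intro ballI)
        fix j assume j: "j \<in> {n - n div N<..n}"
        have d: "n div N \<le> n div 2" using N by (intro div_le_mono2) auto
        have jn: "N0 \<le> j" "j \<le> n" "n \<le> 2 * j" "1 \<le> j" using j d elim N0(1) by auto
        have "real N * real (n div N) \<le> real n"
          unfolding of_nat_mult[symmetric] of_nat_le_iff by (rule times_div_less_eq_dividend)
        moreover have "real n \<le> real j + real (n div N)" using j by auto
        then have "real N * (real n - real j) \<le> real N * real (n div N)"
          by (intro mult_left_mono) auto
        ultimately have "real N * (real n - real j) \<le> real n" by linarith
        then have "(real N - 1) * (real n - real j) \<le> real j" by (simp add: algebra_simps)
        moreover have "1/a * (real n - real j) \<le> (real N - 1) * (real n - real j)"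
          using N(2) jn by (intro mult_right_mono) auto
        ultimately have "(real n - real j) / a \<le> real j" by simp
        then have "real n - real j \<le> a * real j"
          using a by (simp only: pos_divide_le_eq mult.commute)
        then have n_le: "real n \<le> (1 + a) * real j" by (simp add: algebra_simps)
        have pos: "\<phi> n > 0" "\<phi> j > 0" using \<phi>_pos jn by auto
        have "p j = \<phi> j / real j" by (simp add: p_def)
        also have "\<dots> \<le> ((1 + a) * \<phi> n) / (real n / (1 + a))"
          using N0(2)[OF jn(1-3)] n_le pos jn a by (intro frac_le) (auto simp: field_simps)
        also have "\<dots> = (1 + a)\<^sup>2 * p n" by (simp add: p_def power2_eq_square)
        finally have up: "p j \<le> (1 + a)\<^sup>2 * p n" .
        have "(1 - a) * \<phi> n \<le> (1 - a) * ((1 + a) * \<phi> j)"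
          using N0(3)[OF jn(1-3)] a by (intro mult_left_mono) auto
        also have "\<dots> = \<phi> j - a\<^sup>2 * \<phi> j" by (simp add: algebra_simps power2_eq_square)
        also have "\<dots> \<le> \<phi> j" using pos by simp
        finally have "(1 - a) * \<phi> n / real n \<le> \<phi> j / real j"
          using pos jn by (intro frac_le) auto
        with up show "(1 - a) * p n \<le> p j \<and> p j \<le> (1 + a)\<^sup>2 * p n" by (simp add: p_def)
      qed
    qed
  qed (use N in auto)
qed

lemma p_potter_bound:
  obtains y where "y \<ge> 1" "\<And>j n c. y \<le> j \<Longrightarrow> j \<le> n \<Longrightarrow> n \<le> c * j \<Longrightarrow> p j \<le> 2 * (real c)\<^sup>2 * p n"
proof -
  obtain y where y: "y \<ge> 1" "\<And>j n. y \<le> j \<Longrightarrow> j \<le> n \<Longrightarrow> \<phi> j \<le> 2 * (real n / real j) * \<phi> n"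
    using potter_bound by blast
  show thesis
  proof (rule that[OF y(1)])
    fix j n c assume a: "y \<le> j" "j \<le> n" "n \<le> c * j"
    then have [simp]: "j > 0" "n > 0" "j \<noteq> 0" "n \<noteq> 0" using y(1) by auto
    have "real n \<le> real (c * j)" using a(3) by (simp only: of_nat_le_iff)
    then have "real n / real j \<le> real c" by (simp add: field_simps)
    then have sq: "(real n / real j)\<^sup>2 \<le> (real c)\<^sup>2" by (intro power_mono) auto
    have "p j \<le> 2 * (real n / real j) * \<phi> n / real j"
      unfolding p_def using y(2)[OF a(1,2)] by (intro divide_right_mono) auto
    also have "\<dots> = 2 * (real n / real j)\<^sup>2 * p n"
      by (simp add: p_def power2_eq_square field_simps)
    also have "\<dots> \<le> 2 * (real c)\<^sup>2 * p n"
      using sq by (intro mult_right_mono) auto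
    finally show "p j \<le> 2 * (real c)\<^sup>2 * p n" .
  qed
qed

lemma dyadic_p_bound:
  obtains y where "y \<ge> 1"
    "\<And>n j i. y \<le> j \<Longrightarrow> n div 2 ^ i < j \<Longrightarrow> j \<le> n \<Longrightarrow> p j \<le> 2 * 4 ^ i * p n"
proof -
  obtain y where y: "y \<ge> 1" "\<And>j n c. y \<le> j \<Longrightarrow> j \<le> n \<Longrightarrow> n \<le> c * j \<Longrightarrow> p j \<le> 2 * (real c)\<^sup>2 * p n"
    using p_potter_bound by blast
  show thesis
  proof (rule that[OF y(1)])
    fix n j i assume a: "y \<le> j" "n div 2 ^ i < j" "j \<le> n"
    have "n < 2 ^ i + 2 ^ i * (n div 2 ^ i)" by (rule dividend_less_times_div) simp
    also have "\<dots> = 2 ^ i * (n div 2 ^ i + 1)" by (simp add: algebra_simps)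
    also have "\<dots> \<le> 2 ^ i * j" using a by (intro mult_left_mono) auto
    finally have "p j \<le> 2 * (real (2 ^ i))\<^sup>2 * p n" using a by (intro y(2)) auto
    also have "(real (2 ^ i))\<^sup>2 = 4 ^ i"
      by (simp add: power2_eq_square flip: power_mult_distrib)
    finally show "p j \<le> 2 * 4 ^ i * p n" .
  qed
qed

end

section \<open>Nonnegative polynomials as generating functions\<close>

lemma coeff_mult_mono:
  fixes A B R S :: "real poly"
  assumes "\<And>i. 0 \<le> coeff A i" "\<And>i. coeff A i \<le> coeff B i"
    and "\<And>i. 0 \<le> coeff R i" "\<And>i. coeff R i \<le> coeff S i"
  shows "coeff (A * R) n \<le> coeff (B * S) n"
  unfolding coeff_mult by (intro sum_mono mult_mono) (use assms order_trans in blast)+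

lemma coeff_mult_nonneg:
  fixes A B :: "real poly"
  assumes "\<And>i. 0 \<le> coeff A i" "\<And>i. 0 \<le> coeff B i"
  shows "0 \<le> coeff (A * B) n"
  unfolding coeff_mult using assms by (intro sum_nonneg mult_nonneg_nonneg) auto

lemma coeff_power_nonneg:
  fixes A :: "real poly"
  assumes "\<And>i. 0 \<le> coeff A i"
  shows "0 \<le> coeff (A ^ k) n"
proof (induction k arbitrary: n)
  case (Suc k)
  then show ?case using assms by (simp add: coeff_mult_nonneg)
qed auto

lemma coeff_power_mono:
  fixes A B :: "real poly"
  assumes "\<And>i. 0 \<le> coeff B i" "\<And>i. coeff B i \<le> coeff A i"
  shows "coeff (B ^ k) n \<le> coeff (A ^ k) n"
proof (induction k arbitrary: n)
  case (Suc k)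
  then show ?case using assms by (simp add: coeff_mult_mono coeff_power_nonneg)
qed auto

text \<open>
  The union bound over the position of the big jump. If \<open>A\<close> generates all jumps and \<open>B\<close> the
  small ones, then \<open>A ^ k - B ^ k\<close> generates the walks with at least one big jump. In the
  factorisation of \<open>A ^ k - B ^ k\<close> by \<open>A - B\<close>, the \<open>i\<close>-th summand singles out one big jump
  and leaves small steps on one side of it and arbitrary steps on the other; replacing these
  mixed products by powers of \<open>A\<close> or of \<open>B\<close> alone gives the two bounds.
\<close>

lemma coeff_power_diff_bounds:
  fixes A B :: "real poly"
  assumes B: "\<And>i. 0 \<le> coeff B i" and BA: "\<And>i. coeff B i \<le> coeff A i"
  shows "coeff (A ^ k) n - coeff (B ^ k) n \<le> real k * coeff ((A - B) * A ^ (k - 1)) n" (is ?upper)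
    and "coeff (A ^ k) n - coeff (B ^ k) n \<ge> real k * coeff ((A - B) * B ^ (k - 1)) n" (is ?lower)
proof -
  have A: "0 \<le> coeff A i" for i using B BA order_trans by blast
  have D: "0 \<le> coeff (A - B) i" for i using BA by simp
  have diff: "coeff (A ^ k) n - coeff (B ^ k) n = (\<Sum>i<k. coeff ((A - B) * (B ^ (k - Suc i) * A ^ i)) n)"
    by (simp flip: coeff_diff add: power_diff_sumr2 sum_distrib_left coeff_sum)
  have split: "X ^ (k - 1) = X ^ (k - Suc i) * X ^ i" if "i < k" for i and X :: "real poly"
    using that by (simp flip: power_add)
  note mono_rules = coeff_mult_mono coeff_mult_nonneg coeff_power_nonneg coeff_power_mono
    A B BA D order_refl
  have upper: "coeff ((A - B) * (B ^ (k - Suc i) * A ^ i)) n \<le> coeff ((A - B) * A ^ (k - 1)) n" if "i < k" for i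
    unfolding split[OF that] by (intro mono_rules)
  have lower: "coeff ((A - B) * B ^ (k - 1)) n \<le> coeff ((A - B) * (B ^ (k - Suc i) * A ^ i)) n" if "i < k" for i
    unfolding split[OF that] by (intro mono_rules)
  have "(\<Sum>i<k. coeff ((A - B) * (B ^ (k - Suc i) * A ^ i)) n) \<le> (\<Sum>i<k. coeff ((A - B) * A ^ (k - 1)) n)"
    by (intro sum_mono upper) simp
  then show ?upper by (simp add: diff)
  have "(\<Sum>i<k. coeff ((A - B) * B ^ (k - 1)) n) \<le> (\<Sum>i<k. coeff ((A - B) * (B ^ (k - Suc i) * A ^ i)) n)"
    by (intro sum_mono lower) simp
  then show ?lower by (simp add: diff)
qed

lemma sum_coeff_le_poly:
  fixes P :: "real poly"
  assumes "\<And>i. 0 \<le> coeff P i" "0 \<le> x" "finite S"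
  shows "(\<Sum>s\<in>S. coeff P s * x ^ s) \<le> poly P x"
proof -
  have "(\<Sum>s\<in>S. coeff P s * x ^ s) = (\<Sum>s\<in>S \<inter> {..degree P}. coeff P s * x ^ s)"
    using assms by (intro sum.mono_neutral_right) (auto simp: coeff_eq_0 not_le)
  also have "\<dots> \<le> (\<Sum>s\<le>degree P. coeff P s * x ^ s)"
    using assms by (intro sum_mono2) auto
  finally show ?thesis by (simp add: poly_altdef)
qed

lemma exponential_tail_bound:
  fixes P :: "real poly"
  assumes "\<And>i. 0 \<le> coeff P i" "1 \<le> x" "finite S" "\<And>s. s \<in> S \<Longrightarrow> a \<le> s"
  shows "(\<Sum>s\<in>S. coeff P s) * x ^ a \<le> poly P x"
proof -
  have "(\<Sum>s\<in>S. coeff P s) * x ^ a \<le> (\<Sum>s\<in>S. coeff P s * x ^ s)"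
    unfolding sum_distrib_right using assms
    by (intro sum_mono mult_left_mono power_increasing) auto
  also have "\<dots> \<le> poly P x" using assms by (intro sum_coeff_le_poly) auto
  finally show ?thesis .
qed

text \<open>
  Markov's inequality: at \<open>1\<close> the derivative of a generating polynomial is the first moment.
\<close>

lemma markov_tail_bound:
  fixes P :: "real poly"
  assumes "\<And>i. 0 \<le> coeff P i" "finite S" "\<And>s. s \<in> S \<Longrightarrow> a \<le> s"
  shows "real a * (\<Sum>s\<in>S. coeff P s) \<le> poly (pderiv P) 1"
proof -
  have c: "coeff (pCons 0 (pderiv P)) s = real s * coeff P s" for s
    by (cases s) (auto simp: coeff_pderiv)
  have "real a * (\<Sum>s\<in>S. coeff P s) \<le> (\<Sum>s\<in>S. coeff (pCons 0 (pderiv P)) s * 1 ^ s)"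
    unfolding sum_distrib_left c using assms by (auto intro!: sum_mono mult_right_mono)
  also have "\<dots> \<le> poly (pCons 0 (pderiv P)) 1"
    using assms by (intro sum_coeff_le_poly) (simp_all add: c)
  finally show ?thesis by simp
qed

section \<open>Walks with truncated jumps\<close>

context slowly_varying_jumps
begin

definition jump_gf :: "nat \<Rightarrow> real poly" where
  "jump_gf y = (\<Sum>m\<le>y. monom (p m) m)"

definition F :: "nat \<Rightarrow> real" where "F y = (\<Sum>m\<le>y. p m)"

lemma coeff_jump_gf: "coeff (jump_gf y) m = (if m \<le> y then p m else 0)"
  by (simp add: jump_gf_def coeff_sum if_distrib sum.delta cong: if_cong)

lemma coeff_jump_gf_nonneg [simp]: "0 \<le> coeff (jump_gf y) m"
  by (simp add: coeff_jump_gf)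

lemma coeff_jump_gf_power_nonneg [simp]: "0 \<le> coeff (jump_gf y ^ k) m"
  by (intro coeff_power_nonneg) simp

lemma poly_jump_gf: "poly (jump_gf y) x = (\<Sum>m\<le>y. p m * x ^ m)"
  by (simp add: jump_gf_def poly_sum poly_monom)

lemma poly_jump_gf_1: "poly (jump_gf y) 1 = F y"
  by (simp add: poly_jump_gf F_def)

lemma sum_real_mult_p: "(\<Sum>m\<le>y. real m * p m) = (\<Sum>m=1..y. \<phi> m)"
proof -
  have "(\<Sum>m\<le>y. real m * p m) = (\<Sum>m=1..y. real m * p m)"
    by (intro sum.mono_neutral_right) auto
  also have "\<dots> = (\<Sum>m=1..y. \<phi> m)"
    by (intro sum.cong) (auto simp: p_def)
  finally show ?thesis .
qed

lemma poly_pderiv_jump_gf: "poly (pderiv (jump_gf y)) 1 = (\<Sum>m=1..y. \<phi> m)"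
  unfolding sum_real_mult_p[symmetric]
  by (simp add: jump_gf_def higher_pderiv_sum[where n=1, simplified] pderiv_monom poly_sum poly_monom)

lemma F_mono: "x \<le> y \<Longrightarrow> F x \<le> F y"
  unfolding F_def by (intro sum_mono2) auto

lemma F_pos: "y \<ge> 1 \<Longrightarrow> F y > 0"
  unfolding F_def by (rule sum_pos2[of _ 1]) (auto intro: p_pos)

lemma F_nonneg [simp]: "F y \<ge> 0"
  unfolding F_def by (intro sum_nonneg) simp

lemma F_le_1: "F y \<le> 1"
  unfolding F_def using sum_le_suminf[OF sums_summable[OF p_sums], of "{..y}"] sums_unique[OF p_sums] by simp

lemma F_tendsto_1: "F \<longlonglongrightarrow> 1"
  using p_sums unfolding F_def[abs_def] sums_def_le .

text \<open>
  The exponential tilt by \<open>1/y\<close> of the jumps up to \<open>y\<close> costs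
  \<open>(\<Sum>m\<le>y. (exp (m/y) - 1) * p m) = O(\<phi> y)\<close>, by \<open>exp t - 1 \<le> 2 * t\<close> on \<open>[0, 1]\<close> and the
  bound on the first moment. Raising the truncation level from \<open>y\<close> to \<open>K * y\<close> adds mass
  of order \<open>ln K * \<phi> y\<close>, since \<open>\<phi>\<close> is almost constant between the two levels. A large constant
  \<open>K\<close> therefore pays for the tilt. This is what keeps the later estimates proportional to
  \<open>F n ^ k\<close>, however small that factor is.
\<close>

lemma truncated_exponential_moment:
  obtains K y\<^sub>0 where "K \<ge> 1" "y\<^sub>0 \<ge> 1"
    "\<And>y. y \<ge> y\<^sub>0 \<Longrightarrow> poly (jump_gf y) (exp (1 / real y)) \<le> F (K * y)"
proof -
  obtain C where C: "C > 0" "\<And>y. y \<ge> 1 \<Longrightarrow> (\<Sum>m=1..y. \<phi> m) \<le> C * real y * \<phi> y"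
    by (rule karamata_bound) blast
  define s where "s = nat \<lceil>8 * C\<rceil>"
  have s: "8 * C \<le> real s" unfolding s_def by (rule real_nat_ceiling_ge)
  define K :: nat where "K = 2 ^ s"
  have "\<forall>\<^sub>F n in sequentially. \<forall>m\<in>{n..K*n}. \<bar>\<phi> m / \<phi> n - 1\<bar> < 1/2"
    by (rule uniform_convergence) simp
  then obtain N where N: "\<And>n m. n \<ge> N \<Longrightarrow> m \<in> {n..K*n} \<Longrightarrow> \<bar>\<phi> m / \<phi> n - 1\<bar> < 1/2"
    unfolding eventually_sequentially by blast
  have "poly (jump_gf y) (exp (1 / real y)) \<le> F (K * y)" if y: "y \<ge> max N 1" for y
  proof -
    have [simp]: "y > 0" "y \<noteq> 0" "\<phi> y > 0" "\<phi> y \<ge> 0" using y \<phi>_pos[of y] by auto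
    have half: "\<phi> m \<ge> \<phi> y / 2" if "m \<in> {y..K*y}" for m
    proof -
      have "1/2 \<le> \<phi> m / \<phi> y" using N[of y m] that y unfolding abs_less_iff by simp
      then show ?thesis using \<open>\<phi> y > 0\<close> by (simp add: field_simps)
    qed
    \<comment> \<open>Each doubling of the level gains at least a quarter of \<open>\<phi> y\<close>.\<close>
    have grow: "F y + real t * \<phi> y / 4 \<le> F (2 ^ t * y)" if "t \<le> s" for t
      using that
    proof (induction t)
      case (Suc t)
      have "(2::nat) ^ Suc t * y \<le> K * y" unfolding K_def using Suc.prems by (intro mult_right_mono power_increasing) auto
      note le = this
      have "y * 1 \<le> y * 2 ^ t" by (intro mult_left_mono) auto
      then have yle: "y \<le> 2 ^ t * y" by (simp add: mult.commute)
      have "\<phi> y / 4 = (\<Sum>m\<in>{2 ^ t * y<..2 ^ Suc t * y}. \<phi> y / 2 / (2 ^ Suc t * real y))"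
        by (simp add: field_simps)
      also have "\<dots> \<le> (\<Sum>m\<in>{2 ^ t * y<..2 ^ Suc t * y}. p m)"
      proof (intro sum_mono)
        fix m assume m: "m \<in> {2 ^ t * y<..2 ^ Suc t * y}"
        then have m_le: "real m \<le> real (2 ^ Suc t * y)" by (simp only: of_nat_le_iff) simp
        have mK: "m \<in> {y..K * y}"
          using m le yle unfolding greaterThanAtMost_iff atLeastAtMost_iff by linarith
        have "\<phi> m \<ge> 0" using \<phi>_pos[of m] m by (auto intro: less_imp_le)
        with m_le show "\<phi> y / 2 / (2 ^ Suc t * real y) \<le> p m"
          using m half[OF mK] unfolding p_def by (intro frac_le) auto
      qed
      also have "\<dots> = F (2 ^ Suc t * y) - F (2 ^ t * y)"
      proof -
        have "{..2 ^ Suc t * y} = {..2 ^ t * y} \<union> {2 ^ t * y<..2 ^ Suc t * y}" by auto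
        then have "F (2 ^ Suc t * y) = F (2 ^ t * y) + (\<Sum>m\<in>{2 ^ t * y<..2 ^ Suc t * y}. p m)"
          unfolding F_def by (simp only:) (intro sum.union_disjoint, auto)
        then show ?thesis by simp
      qed
      finally show ?case using Suc by (simp add: field_simps)
    qed simp
    have "poly (jump_gf y) (exp (1 / real y)) = (\<Sum>m\<le>y. p m * exp (real m / real y))"
      by (simp add: poly_jump_gf flip: exp_of_nat_mult)
    also have "\<dots> \<le> (\<Sum>m\<le>y. p m * (1 + 2 * (real m / real y)))"
    proof (intro sum_mono mult_left_mono)
      fix m assume "m \<in> {..y}"
      then have x: "0 \<le> real m / real y" "real m / real y \<le> 1" by auto
      have "exp (real m / real y) \<le> 1 + real m / real y + (real m / real y)\<^sup>2"
        using x by (rule exp_bound)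
      also have "(real m / real y)\<^sup>2 \<le> real m / real y"
        using mult_left_le[OF x(2,1)] by (simp only: power2_eq_square)
      finally show "exp (real m / real y) \<le> 1 + 2 * (real m / real y)" by simp
    qed simp
    also have "\<dots> = F y + 2 / real y * (\<Sum>m\<le>y. real m * p m)"
      by (simp add: F_def sum.distrib sum_distrib_left algebra_simps)
    also have "(\<Sum>m\<le>y. real m * p m) = (\<Sum>m=1..y. \<phi> m)"
      by (rule sum_real_mult_p)
    also have "F y + 2 / real y * \<dots> \<le> F y + 2 / real y * (C * real y * \<phi> y)"
      using C(2)[of y] \<open>y > 0\<close> by (intro add_left_mono mult_left_mono) auto
    also have "\<dots> = F y + 8 * C * \<phi> y / 4" by simp
    also have "\<dots> \<le> F y + real s * \<phi> y / 4"
      using s by (intro add_left_mono divide_right_mono mult_right_mono) auto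
    also have "\<dots> \<le> F (K * y)" using grow[of s] by (simp add: K_def)
    finally show ?thesis .
  qed
  then show thesis by (intro that[of K "max N 1"]) (auto simp: K_def)
qed

lemma coeff_jump_gf_diff_mult:
  assumes "x \<le> y"
  shows "coeff ((jump_gf y - jump_gf x) * R) n = (\<Sum>j\<in>{x<..min y n}. p j * coeff R (n - j))"
  unfolding coeff_mult
  by (rule sum.mono_neutral_cong_right) (use assms in \<open>auto simp: coeff_jump_gf\<close>)

lemma coeff_jump_gf_mono: "x \<le> y \<Longrightarrow> coeff (jump_gf x) i \<le> coeff (jump_gf y) i"
  by (simp add: coeff_jump_gf)

lemma coeff_jump_gf_power_mono: "x \<le> y \<Longrightarrow> coeff (jump_gf x ^ k) i \<le> coeff (jump_gf y ^ k) i"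
  by (intro coeff_power_mono coeff_jump_gf_mono) auto

text \<open>
  Walks of \<open>k\<close> steps to \<open>n\<close> whose largest jump lies in \<open>{x<..y}\<close>: there are \<open>k\<close> positions for
  a jump \<open>j\<close> of that size, of weight at most \<open>P\<close>, and the remaining steps must reach
  exactly \<open>n - j\<close>. Summing over \<open>j\<close> turns the local event for the remaining steps into
  a tail event, which removes one order of difficulty.
\<close>

lemma jumps_between_upper:
  assumes xy: "x \<le> y" "y \<le> n" and P: "\<And>j. x < j \<Longrightarrow> j \<le> y \<Longrightarrow> p j \<le> P" and "P \<ge> 0"
  shows "coeff (jump_gf y ^ k) n
    \<le> coeff (jump_gf x ^ k) n + real k * P * (\<Sum>s\<in>{n - y..n}. coeff (jump_gf y ^ (k - 1)) s)"
proof -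
  let ?R = "jump_gf y ^ (k - 1)"
  have "coeff (jump_gf y ^ k) n - coeff (jump_gf x ^ k) n \<le> real k * coeff ((jump_gf y - jump_gf x) * ?R) n"
    using xy by (intro coeff_power_diff_bounds(1) coeff_jump_gf_mono) auto
  also have "coeff ((jump_gf y - jump_gf x) * ?R) n = (\<Sum>j\<in>{x<..y}. p j * coeff ?R (n - j))"
    using xy by (simp add: coeff_jump_gf_diff_mult)
  also have "\<dots> \<le> (\<Sum>j\<in>{x<..y}. P * coeff ?R (n - j))"
    using P by (intro sum_mono mult_right_mono) auto
  also have "\<dots> = P * (\<Sum>j\<in>{x<..y}. coeff ?R (n - j))" by (simp add: sum_distrib_left)
  also have "(\<Sum>j\<in>{x<..y}. coeff ?R (n - j)) = (\<Sum>s\<in>(\<lambda>j. n - j) ` {x<..y}. coeff ?R s)"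
    using xy by (subst sum.reindex) (auto simp: inj_on_def)
  also have "\<dots> \<le> (\<Sum>s\<in>{n - y..n}. coeff ?R s)"
    using xy by (intro sum_mono2) auto
  finally show ?thesis using \<open>P \<ge> 0\<close> by (simp add: mult_left_mono mult.assoc)
qed

text \<open>
  Here exactly one jump exceeds \<open>x\<close>, so that no walk is counted twice.
\<close>

lemma jumps_between_lower:
  assumes xy: "x \<le> n" and P: "\<And>j. x < j \<Longrightarrow> j \<le> n \<Longrightarrow> P \<le> p j"
  shows "coeff (jump_gf n ^ k) n \<ge> real k * P * (\<Sum>s<n - x. coeff (jump_gf x ^ (k - 1)) s)"
proof -
  let ?R = "jump_gf x ^ (k - 1)"
  have "(\<lambda>j. n - j) ` {x<..n} = {..<n - x}"
  proof (intro equalityI subsetI)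
    fix s assume "s \<in> {..<n - x}"
    then show "s \<in> (\<lambda>j. n - j) ` {x<..n}" by (intro image_eqI[of _ _ "n - s"]) auto
  qed auto
  then have "P * (\<Sum>s<n - x. coeff ?R s) = P * (\<Sum>s\<in>(\<lambda>j. n - j) ` {x<..n}. coeff ?R s)" by simp
  also have "\<dots> = (\<Sum>j\<in>{x<..n}. P * coeff ?R (n - j))"
    by (subst sum.reindex) (auto simp: inj_on_def sum_distrib_left)
  also have "\<dots> \<le> (\<Sum>j\<in>{x<..n}. p j * coeff ?R (n - j))"
    using P by (intro sum_mono mult_right_mono) auto
  also have "\<dots> = coeff ((jump_gf n - jump_gf x) * ?R) n"
    using xy by (simp add: coeff_jump_gf_diff_mult)
  finally have "real k * (P * (\<Sum>s<n - x. coeff ?R s)) \<le> real k * \<dots>"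
    by (intro mult_left_mono) auto
  also have "\<dots> \<le> coeff (jump_gf n ^ k) n - coeff (jump_gf x ^ k) n"
    using xy by (intro coeff_power_diff_bounds(2) coeff_jump_gf_mono) auto
  also have "\<dots> \<le> coeff (jump_gf n ^ k) n" by simp
  finally show ?thesis by (simp add: mult.assoc)
qed

lemma sum_coeff_jump_gf_power_le:
  assumes "finite S"
  shows "(\<Sum>s\<in>S. coeff (jump_gf y ^ k) s) \<le> F y ^ k"
  using exponential_tail_bound[of "jump_gf y ^ k" 1 S 0] assms by (simp add: poly_jump_gf_1)

text \<open>
  The moment hypothesis comes from \<open>truncated_exponential_moment\<close>. The exponential decay in
  \<open>a / y\<close> then comes at no cost in the factor \<open>F n ^ k\<close>.
\<close>

lemma chernoff_bound:
  assumes moment: "poly (jump_gf y) (exp (1 / real y)) \<le> F n" and "y \<ge> 1"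
    and S: "finite S" "\<And>s. s \<in> S \<Longrightarrow> a \<le> s"
  shows "(\<Sum>s\<in>S. coeff (jump_gf y ^ k) s) \<le> exp (- real a / real y) * F n ^ k"
proof -
  have "(\<Sum>s\<in>S. coeff (jump_gf y ^ k) s) * exp (1 / real y) ^ a \<le> poly (jump_gf y ^ k) (exp (1 / real y))"
    using S by (intro exponential_tail_bound) auto
  also have "\<dots> \<le> F n ^ k"
    unfolding poly_power using moment
    by (intro power_mono) (auto simp: poly_jump_gf intro!: sum_nonneg)
  finally have "(\<Sum>s\<in>S. coeff (jump_gf y ^ k) s) * exp (real a / real y) \<le> F n ^ k"
    by (simp flip: exp_of_nat_mult)
  then show ?thesis by (simp add: exp_minus field_simps)
qed

text \<open>
  The first moment of a jump truncated at \<open>n\<close> is \<open>O(n * \<phi> n)\<close>, so \<open>k - 1\<close> such jumps reach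
  a fixed fraction of \<open>n\<close> with weight of order \<open>k * \<phi> n\<close> relative to \<open>F n ^ k\<close>. This is where
  the product \<open>k * \<phi> n\<close> enters the error term.
\<close>

lemma markov_bound:
  assumes C: "C > 0" "(\<Sum>m=1..n. \<phi> m) \<le> C * real n * \<phi> n"
    and "N \<ge> 1" "N \<le> n" "1/2 \<le> F n" "k \<ge> 1"
    and S: "finite S" "\<And>s. s \<in> S \<Longrightarrow> n div N \<le> s"
  shows "(\<Sum>s\<in>S. coeff (jump_gf n ^ (k - 1)) s) \<le> 8 * C * real N * (real k * \<phi> n) * F n ^ k"
proof -
  define d where "d = n div N"
  have \<phi>: "\<phi> n \<ge> 0" using \<phi>_pos[of n] assms by auto
  have "d \<ge> 1" unfolding d_def using assms by (simp add: Suc_le_eq div_greater_zero_iff)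
  then have "N * 1 \<le> N * d" by (rule mult_le_mono2)
  moreover have "n < N + N * d"
    unfolding d_def using assms by (intro dividend_less_times_div) auto
  ultimately have "real n \<le> real (2 * (N * d))" unfolding of_nat_le_iff by linarith
  then have d: "real n \<le> 2 * real N * real d" "d \<ge> 1"
    using \<open>d \<ge> 1\<close> by simp_all
  have "real d * (\<Sum>s\<in>S. coeff (jump_gf n ^ (k - 1)) s) \<le> poly (pderiv (jump_gf n ^ (k - 1))) 1"
    using S by (intro markov_tail_bound) (auto simp: d_def)
  also have "\<dots> = real (k - 1) * F n ^ (k - 1 - 1) * (\<Sum>m=1..n. \<phi> m)"
    by (simp add: pderiv_power poly_pderiv_jump_gf poly_jump_gf_1)
  also have "\<dots> \<le> real k * (4 * F n ^ k) * (C * real n * \<phi> n)"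
  proof (intro mult_mono C)
    have "F n ^ (k - 1 - 1) * (1/2)\<^sup>2 \<le> F n ^ (k - 1 - 1) * (F n)\<^sup>2"
      using assms by (intro mult_left_mono power_mono) auto
    also have "\<dots> = F n ^ (k - 1 - 1 + 2)" by (simp flip: power_add)
    also have "\<dots> \<le> F n ^ k" using F_le_1 by (intro power_decreasing) auto
    finally show "F n ^ (k - 1 - 1) \<le> 4 * F n ^ k" by (simp add: power2_eq_square)
  qed (use \<phi> C(1) in \<open>auto intro!: sum_nonneg less_imp_le[OF \<phi>_pos]\<close>)
  also have "\<dots> = real n * (real k * (4 * F n ^ k) * (C * \<phi> n))" by simp
  also have "\<dots> \<le> 2 * real N * real d * (real k * (4 * F n ^ k) * (C * \<phi> n))"
    using d \<phi> C by (intro mult_right_mono) auto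
  also have "\<dots> = real d * (8 * C * real N * (real k * \<phi> n) * F n ^ k)" by simp
  finally show ?thesis using d(2) by simp
qed

end

section \<open>Walks without a jump of order n\<close>

lemma exp_minus_le_inverse_power4:
  fixes x :: real
  assumes "x > 0"
  shows "exp (- x) \<le> 256 / x ^ 4"
proof -
  have "(x / 4) ^ 4 \<le> exp (x / 4) ^ 4"
    using assms exp_ge_add_one_self[of "x / 4"] by (intro power_mono) linarith+
  also have "exp (x / 4) ^ 4 = exp x" using exp_of_nat_mult[of 4 "x / 4"] by simp
  finally show ?thesis using assms by (simp add: power_divide exp_minus field_simps)
qed

lemma four_power_mult_exp_bound: "4 ^ i * exp (1 - 2 ^ i) \<le> 768 * (1 / 4 :: real) ^ i"
proof -
  define x :: real where "x = 2 ^ i"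
  have x: "x > 0" by (simp add: x_def)
  have "x\<^sup>2 * exp (1 - x) = exp 1 * (x\<^sup>2 * exp (- x))" using exp_add[of 1 "- x"] by simp
  also have "\<dots> \<le> 3 * (x\<^sup>2 * (256 / x ^ 4))"
    using x by (intro mult_mono exp_le exp_minus_le_inverse_power4) auto
  also have "\<dots> = 768 * (1 / x\<^sup>2)" using x by (simp add: power2_eq_square power4_eq_xxxx)
  also have "x\<^sup>2 = 4 ^ i" by (simp add: x_def power2_eq_square flip: power_mult_distrib)
  finally show ?thesis by (simp add: x_def power_one_over)
qed

context slowly_varying_jumps
begin

text \<open>
  Reaching \<open>n\<close> without a jump above \<open>n / 2 ^ I\<close> is split according to the dyadic block
  \<open>{n div 2 ^ (i + 1)<..n div 2 ^ i}\<close> that contains the largest jump. In block \<open>i\<close> a jump has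
  weight at most \<open>8 * 4 ^ i * p n\<close>, and the other steps, all of size at most \<open>y = n div 2 ^ i\<close>,
  must cover at least \<open>n - y\<close>, which costs \<open>exp (1 - n / y) \<le> exp (1 - 2 ^ i)\<close>. The products are
  summable in \<open>i\<close>, and the tail of the series beyond \<open>I\<close> is as small as desired. The blocks stop
  at a constant level \<open>Y\<close>, below which the asymptotic estimates are unavailable; walks with all
  jumps at most \<open>Y\<close> cost \<open>exp (- n / Y)\<close>, which is far below \<open>p n\<close>.
\<close>

lemma small_jumps_negligible:
  assumes "\<eta> > 0"
  obtains I where "\<forall>\<^sub>F n in sequentially. \<forall>k\<ge>1.
    coeff (jump_gf (n div 2 ^ I) ^ k) n \<le> \<eta> * real k * p n * F n ^ k"
proof -
  obtain K y0 where K: "K \<ge> 1" "y0 \<ge> 1"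
    "\<And>y. y \<ge> y0 \<Longrightarrow> poly (jump_gf y) (exp (1 / real y)) \<le> F (K * y)"
    by (rule truncated_exponential_moment) blast
  obtain y1 where y1: "y1 \<ge> 1" "\<And>j n c. y1 \<le> j \<Longrightarrow> j \<le> n \<Longrightarrow> n \<le> c * j \<Longrightarrow> p j \<le> 2 * (real c)\<^sup>2 * p n"
    using p_potter_bound by blast
  obtain y2 where y2: "y2 \<ge> 1"
    "\<And>n j i. y2 \<le> j \<Longrightarrow> n div 2 ^ i < j \<Longrightarrow> j \<le> n \<Longrightarrow> p j \<le> 2 * 4 ^ i * p n"
    by (rule dyadic_p_bound) blast
  define Y where "Y = max y0 (max y1 y2)"
  have Y: "y0 \<le> Y" "y1 \<le> Y" "y2 \<le> Y" "1 \<le> Y" using y1(1) by (auto simp: Y_def)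
  have "(\<lambda>I. 32768 * (1 / 4 :: real) ^ I) \<longlonglongrightarrow> 32768 * 0"
    by (intro tendsto_intros LIMSEQ_power_zero) auto
  then have "\<forall>\<^sub>F I in sequentially. 32768 * (1 / 4 :: real) ^ I < \<eta>"
    using assms by (intro order_tendstoD) auto
  then have "\<forall>\<^sub>F I in sequentially. 32768 * (1 / 4 :: real) ^ I < \<eta> \<and> I \<ge> K"
    using eventually_ge_at_top[of K] by eventually_elim simp
  then obtain I where I: "32768 * (1 / 4 :: real) ^ I < \<eta>" "K \<le> I"
    unfolding eventually_sequentially by blast
  have KI: "K \<le> 2 ^ i" if "I \<le> i" for i
    using I(2) that less_exp[of i] by linarith
  have moment: "poly (jump_gf y) (exp (1 / real y)) \<le> F n" if "Y \<le> y" "K * y \<le> n" for y n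
    using K(3)[of y] F_mono[OF that(2)] that(1) Y(1) by simp
  have "(\<lambda>n. 256 * real Y ^ 4 / real n) \<longlonglongrightarrow> 0" by (rule lim_const_over_n)
  moreover have "\<eta> / 4 * p Y > 0" using assms p_pos[of Y] Y by simp
  ultimately have ev1: "\<forall>\<^sub>F n in sequentially. 256 * real Y ^ 4 / real n < \<eta> / 4 * p Y"
    by (intro order_tendstoD)
  have ev2: "\<forall>\<^sub>F n in sequentially. F n > 1/2"
    using F_tendsto_1 by (intro order_tendstoD) auto
  have "\<forall>\<^sub>F n in sequentially. \<forall>k\<ge>1.
    coeff (jump_gf (n div 2 ^ I) ^ k) n \<le> \<eta> * real k * p n * F n ^ k"
    using ev1 ev2 eventually_ge_at_top[of "max I (K * Y)"]
  proof eventually_elim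
    case (elim n)
    have n: "I \<le> n" "K * Y \<le> n" using elim(3) by auto
    have "Y \<le> K * Y" using mult_le_mono1[OF K(1), of Y] by simp
    then have nY: "Y \<le> n" "1 \<le> n" using n Y by linarith+
    show ?case
    proof (intro allI impI)
      fix k :: nat assume k: "k \<ge> 1"
      \<comment> \<open>The block boundaries, cut off at \<open>Y\<close>; from \<open>i = n\<close> on they all equal \<open>Y\<close>.\<close>
      define z where "z i = max Y (n div 2 ^ i)" for i
      define c where "c i = coeff (jump_gf (z i) ^ k) n" for i
      define B where "B = real k * p n * F n ^ k"
      have B: "B \<ge> 0" by (simp add: B_def)
      have FF: "F n ^ (k - 1) \<le> 2 * F n ^ k"
      proof -
        have "F n ^ (k - 1) * 1 \<le> F n ^ (k - 1) * (2 * F n)"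
          using elim(2) by (intro mult_left_mono) auto
        also have "\<dots> = 2 * F n ^ k" using k by (cases k) auto
        finally show ?thesis by simp
      qed
      have step: "c i - c (Suc i) \<le> 12288 * (1 / 4) ^ i * B" if i: "I \<le> i" for i
      proof (cases "n div 2 ^ i \<le> Y")
        case True
        have "n div 2 ^ Suc i \<le> n div 2 ^ i" by (intro div_le_mono2) auto
        with True have "z (Suc i) = z i" by (auto simp: z_def)
        with B show ?thesis by (simp add: c_def)
      next
        case False
        define y where "y = n div 2 ^ i"
        define x where "x = z (Suc i)"
        have y: "z i = y" "Y < y" "y \<le> n" using False by (auto simp: z_def y_def)
        have "n div 2 ^ Suc i \<le> n div 2 ^ i" by (intro div_le_mono2) auto
        with y have x: "Y \<le> x" "n div 2 ^ Suc i \<le> x" "x \<le> y" by (auto simp: x_def z_def y_def)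
        have "K * y \<le> 2 ^ i * (n div 2 ^ i)"
          unfolding y_def using KI[OF i] by (intro mult_right_mono) auto
        also have "\<dots> \<le> n" by (rule times_div_less_eq_dividend)
        finally have Ky: "K * y \<le> n" .
        have P: "p j \<le> 8 * 4 ^ i * p n" if j: "x < j" "j \<le> y" for j
        proof -
          have "y2 \<le> j" "n div 2 ^ Suc i < j" "j \<le> n" using j x y(3) Y(3) by linarith+
          from y2(2)[OF this] show ?thesis by simp
        qed
        have "real (2 ^ i * (n div 2 ^ i)) \<le> real n"
          unfolding of_nat_le_iff by (rule times_div_less_eq_dividend)
        then have "2 ^ i * real y \<le> real n" by (simp add: y_def)
        moreover have ypos: "real y > 0" using y by simp
        ultimately have "- real (n - y) / real y \<le> 1 - 2 ^ i"
          using y(3) by (simp add: field_simps of_nat_diff)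
        then have e: "exp (- real (n - y) / real y) \<le> exp (1 - 2 ^ i)" by simp
        have "(\<Sum>s\<in>{n - y..n}. coeff (jump_gf y ^ (k - 1)) s)
            \<le> exp (- real (n - y) / real y) * F n ^ (k - 1)"
          using y Ky by (intro chernoff_bound moment) auto
        also have "\<dots> \<le> exp (1 - 2 ^ i) * (2 * F n ^ k)"
          using e FF by (intro mult_mono) auto
        finally have S: "(\<Sum>s\<in>{n - y..n}. coeff (jump_gf y ^ (k - 1)) s) \<le> exp (1 - 2 ^ i) * (2 * F n ^ k)" .
        have "c i - c (Suc i) \<le> real k * (8 * 4 ^ i * p n) * (\<Sum>s\<in>{n - y..n}. coeff (jump_gf y ^ (k - 1)) s)"
          unfolding c_def y(1) x_def[symmetric]
          using jumps_between_upper[OF x(3) y(3) P, of k] by simp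
        also have "\<dots> \<le> real k * (8 * 4 ^ i * p n) * (exp (1 - 2 ^ i) * (2 * F n ^ k))"
          using S by (intro mult_left_mono) auto
        also have "\<dots> = 16 * (4 ^ i * exp (1 - 2 ^ i)) * B" by (simp add: B_def)
        also have "\<dots> \<le> 16 * (768 * (1 / 4) ^ i) * B"
          using B by (intro mult_right_mono mult_left_mono four_power_mult_exp_bound) auto
        finally show ?thesis by simp
      qed
      have geo: "(\<Sum>i\<in>{I..<n}. (1 / 4 :: real) ^ i) \<le> 4 / 3 * (1 / 4) ^ I"
      proof -
        have "(\<Sum>i\<in>{I..<n}. (1 / 4 :: real) ^ i) = 4 / 3 * ((1 / 4) ^ I - (1 / 4) ^ n)"
          using n(1) by (induction rule: dec_induct) auto
        then show ?thesis by simp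
      qed
      have "coeff (jump_gf (n div 2 ^ I) ^ k) n \<le> c I"
        unfolding c_def z_def by (intro coeff_jump_gf_power_mono) auto
      also have "c I = c n + (\<Sum>i\<in>{I..<n}. c i - c (Suc i))"
        using sum_Suc_diff'[of I n "\<lambda>i. - c i"] n(1) by simp
      also have "(\<Sum>i\<in>{I..<n}. c i - c (Suc i)) \<le> (\<Sum>i\<in>{I..<n}. 12288 * (1 / 4) ^ i * B)"
        by (intro sum_mono step) auto
      also have "\<dots> = 12288 * B * (\<Sum>i\<in>{I..<n}. (1 / 4) ^ i)"
        unfolding sum_distrib_left by (intro sum.cong) auto
      also have "\<dots> \<le> 12288 * B * (4 / 3 * (1 / 4) ^ I)"
        using B by (intro mult_left_mono geo) auto
      also have "\<dots> = 32768 * (1 / 4) ^ I * (B / 2)" by simp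
      also have "\<dots> \<le> \<eta> * (B / 2)"
        using I(1) B by (intro mult_right_mono) auto
      also have "c n \<le> \<eta> / 2 * B"
      proof -
        have "z n = Y" using less_exp[of n] by (simp add: z_def)
        then have "c n = (\<Sum>s\<in>{n}. coeff (jump_gf Y ^ k) s)" by (simp add: c_def)
        also have "\<dots> \<le> exp (- real n / real Y) * F n ^ k"
          using n Y by (intro chernoff_bound moment) auto
        also have "exp (- real n / real Y) \<le> \<eta> / 2 * p n"
        proof -
          \<comment> \<open>The crude consequence \<open>p n \<ge> p Y / (2 * n\<^sup>2)\<close> of the Potter bound suffices here.\<close>
          have n0: "real n \<ge> 1" "real n > 0" using nY by auto
          have "p Y \<le> 2 * (real n)\<^sup>2 * p n"
            using nY Y by (intro y1(2)) auto
          then have "\<eta> / 4 * p Y \<le> \<eta> / 4 * (2 * (real n)\<^sup>2 * p n)"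
            using assms by (intro mult_left_mono) auto
          with elim(1) have "256 * real Y ^ 4 / real n \<le> \<eta> / 2 * p n * (real n)\<^sup>2" by simp
          then have "256 * real Y ^ 4 / real n / (real n)\<^sup>2 \<le> \<eta> / 2 * p n"
            using n0 by (simp only: divide_le_eq zero_less_power if_True)
          have "256 / (real n / real Y) ^ 4 = 256 * real Y ^ 4 / (real n * (real n)\<^sup>2 * real n)"
            by (simp add: power_divide power2_eq_square power4_eq_xxxx)
          also have "\<dots> \<le> 256 * real Y ^ 4 / (real n * (real n)\<^sup>2 * 1)"
            using n0 by (intro divide_left_mono mult_left_mono) auto
          also have "\<dots> \<le> \<eta> / 2 * p n"
            using \<open>256 * real Y ^ 4 / real n / (real n)\<^sup>2 \<le> \<eta> / 2 * p n\<close> by simp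
          finally show ?thesis
            using exp_minus_le_inverse_power4[of "real n / real Y"] nY Y by simp
        qed
        finally have "c n \<le> \<eta> / 2 * (p n * F n ^ k)" by (simp add: mult_right_mono)
        also have "\<dots> \<le> \<eta> / 2 * B"
        proof (intro mult_left_mono)
          have "1 * (p n * F n ^ k) \<le> real k * (p n * F n ^ k)"
            using k by (intro mult_right_mono) auto
          then show "p n * F n ^ k \<le> B" by (simp add: B_def mult.assoc)
        qed (use assms in auto)
        finally show ?thesis .
      qed
      finally have "coeff (jump_gf (n div 2 ^ I) ^ k) n \<le> \<eta> * B" by (simp add: mult_ac)
      then show "coeff (jump_gf (n div 2 ^ I) ^ k) n \<le> \<eta> * real k * p n * F n ^ k"
        by (simp add: B_def mult.assoc)
    qed
  qed
  then show thesis by (rule that)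
qed

section \<open>Local estimates\<close>

lemma coeff_jump_gf_power_eq:
  assumes "s \<le> x" "s \<le> y"
  shows "coeff (jump_gf x ^ k) s = coeff (jump_gf y ^ k) s"
  using assms
proof (induction k arbitrary: s)
  case (Suc k)
  then show ?case
    by (auto simp: coeff_mult coeff_jump_gf intro!: sum.cong)
qed auto

lemma eventually_div_ge: "\<forall>\<^sub>F n in sequentially. y \<le> n div 2 ^ I"
  using eventually_ge_at_top[of "y * 2 ^ I"]
  by eventually_elim (simp add: less_eq_div_iff_mult_less_eq)

lemma F_power_pred_le:
  assumes "1 \<le> c * F n" "k \<ge> 1"
  shows "F n ^ (k - 1) \<le> c * F n ^ k"
proof -
  have "F n ^ (k - 1) * 1 \<le> F n ^ (k - 1) * (c * F n)"
    using assms by (intro mult_left_mono) auto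
  also have "\<dots> = c * F n ^ k" using assms by (cases k) auto
  finally show ?thesis by simp
qed

lemma eventually_F_ge:
  assumes "c > 1"
  shows "\<forall>\<^sub>F n in sequentially. 1 \<le> c * F n"
proof -
  have "\<forall>\<^sub>F n in sequentially. F n > 1 / c"
    using F_tendsto_1 assms by (intro order_tendstoD) auto
  then show ?thesis by eventually_elim (use \<open>c > 1\<close> in \<open>simp add: field_simps\<close>)
qed

text \<open>
  Jumps above \<open>n / 2 ^ I\<close>, for a fixed \<open>I\<close>, have weight at most a constant times \<open>p n\<close>, and the
  remaining steps may then be anywhere, with total weight \<open>F n ^ (k - 1)\<close>.
\<close>

lemma uniform_local_bound:
  "\<exists>c>0. \<forall>\<^sub>F n in sequentially. \<forall>k\<ge>1. coeff (jump_gf n ^ k) n \<le> c * real k * p n * F n ^ k"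
proof -
  obtain I where I: "\<forall>\<^sub>F n in sequentially. \<forall>k\<ge>1. coeff (jump_gf (n div 2 ^ I) ^ k) n \<le> 1 * real k * p n * F n ^ k"
    using small_jumps_negligible[of 1] by auto
  obtain y where y: "y \<ge> 1"
    "\<And>n j i. y \<le> j \<Longrightarrow> n div 2 ^ i < j \<Longrightarrow> j \<le> n \<Longrightarrow> p j \<le> 2 * 4 ^ i * p n"
    by (rule dyadic_p_bound) blast
  have "\<forall>\<^sub>F n in sequentially. \<forall>k\<ge>1. coeff (jump_gf n ^ k) n \<le> (1 + 4 * 4 ^ I) * real k * p n * F n ^ k"
    using I eventually_div_ge[of y I] eventually_F_ge[of 2, simplified]
  proof eventually_elim
    case (elim n)
    show ?case
    proof (intro allI impI)
      fix k :: nat assume k: "k \<ge> 1"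
      have "coeff (jump_gf n ^ k) n \<le> coeff (jump_gf (n div 2 ^ I) ^ k) n
          + real k * (2 * 4 ^ I * p n) * (\<Sum>s\<in>{n - n..n}. coeff (jump_gf n ^ (k - 1)) s)"
        using elim(2) y by (intro jumps_between_upper) auto
      also have "\<dots> \<le> 1 * real k * p n * F n ^ k + real k * (2 * 4 ^ I * p n) * (2 * F n ^ k)"
      proof (intro add_mono mult_left_mono)
        show "(\<Sum>s\<in>{n - n..n}. coeff (jump_gf n ^ (k - 1)) s) \<le> 2 * F n ^ k"
          using sum_coeff_jump_gf_power_le[of "{n - n..n}" n "k - 1"] F_power_pred_le[OF elim(3) k] by simp
      qed (use elim(1) k in auto)
      also have "\<dots> = (1 + 4 * 4 ^ I) * real k * p n * F n ^ k" by (simp add: algebra_simps)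
      finally show "coeff (jump_gf n ^ k) n \<le> (1 + 4 * 4 ^ I) * real k * p n * F n ^ k" .
    qed
  qed
  then show ?thesis by (intro exI[of _ "1 + 4 * 4 ^ I"] conjI) (auto intro: add_pos_nonneg)
qed

text \<open>
  The largest jump is compared with \<open>n\<close> on three scales. Up to a small fraction of \<open>n\<close> it is
  negligible by \<open>small_jumps_negligible\<close>. Between that fraction and \<open>n - d\<close>, where
  \<open>d = n div N\<close>, the other steps have to cover at least \<open>d\<close>, which costs a factor of order
  \<open>k * \<phi> n\<close> by \<open>markov_bound\<close>. Above \<open>n - d\<close> the weight of the jump is almost \<open>p n\<close>, and the other
  steps contribute \<open>F n ^ (k - 1)\<close> up to the same Markov error.
\<close>

lemma local_asymptotics:
  assumes "\<eta> > 0"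
  obtains C where "\<forall>\<^sub>F n in sequentially. \<forall>k\<ge>1.
    \<bar>coeff (jump_gf n ^ k) n - real k * p n * F n ^ k\<bar>
      \<le> (\<eta> + C * (real k * \<phi> n)) * (real k * p n * F n ^ k)"
proof -
  \<comment> \<open>The upper bound loses \<open>(1 + a) ^ 3 \<le> 1 + 7 * a\<close>, to be at most \<open>1 + \<eta> / 2\<close>.\<close>
  define a where "a = min 1 \<eta> / 14"
  have a: "0 < a" "a \<le> 1" "14 * a \<le> \<eta>" using assms by (auto simp: a_def)
  obtain I where I: "\<forall>\<^sub>F n in sequentially. \<forall>k\<ge>1. coeff (jump_gf (n div 2 ^ I) ^ k) n \<le> \<eta> / 2 * real k * p n * F n ^ k"
    using small_jumps_negligible[of "\<eta> / 2"] assms by auto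
  obtain y where y: "y \<ge> 1"
    "\<And>n j i. y \<le> j \<Longrightarrow> n div 2 ^ i < j \<Longrightarrow> j \<le> n \<Longrightarrow> p j \<le> 2 * 4 ^ i * p n"
    by (rule dyadic_p_bound) blast
  obtain N where N: "N \<ge> 2"
    "\<forall>\<^sub>F n in sequentially. \<forall>j\<in>{n - n div N<..n}. (1 - a) * p n \<le> p j \<and> p j \<le> (1 + a)\<^sup>2 * p n"
    using p_comparable[OF a(1,2)] by blast
  obtain C where C: "C > 0" "\<And>y. y \<ge> 1 \<Longrightarrow> (\<Sum>m=1..y. \<phi> m) \<le> C * real y * \<phi> y"
    by (rule karamata_bound) blast
  have F_near_1: "\<forall>\<^sub>F n in sequentially. 1 \<le> (1 + a) * F n"
    using a by (intro eventually_F_ge) simp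
  define C' where "C' = 8 * C * real N"
  have "\<forall>\<^sub>F n in sequentially. \<forall>k\<ge>1.
    \<bar>coeff (jump_gf n ^ k) n - real k * p n * F n ^ k\<bar>
      \<le> (\<eta> + 2 * 4 ^ Suc I * C' * (real k * \<phi> n)) * (real k * p n * F n ^ k)"
    using I N(2) eventually_div_ge[of y "Suc I"] eventually_F_ge[of 2, simplified]
      F_near_1 eventually_ge_at_top[of N]
  proof eventually_elim
    case (elim n)
    have n: "N \<le> n" "1 \<le> n" using N(1) elim by auto
    have half: "1 / 2 \<le> F n" using elim(4) by simp
    define d where "d = n div N"
    define x where "x = n div 2 ^ Suc I"
    have "d \<le> n div 2" unfolding d_def using N(1) by (intro div_le_mono2) auto
    moreover have "x \<le> n div 2" unfolding x_def by (intro div_le_mono2) auto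
    ultimately have dx: "x \<le> n - d" "d \<le> n - d" "d \<le> n" "n - (n - d) = d" by linarith+
    have \<phi>: "\<phi> n \<ge> 0" using \<phi>_pos[of n] n by simp
    show ?case
    proof (intro allI impI)
      fix k :: nat assume k: "k \<ge> 1"
      define B where "B = real k * p n * F n ^ k"
      define T where "T = C' * (real k * \<phi> n)"
      have B: "B \<ge> 0" by (simp add: B_def)
      have T: "T \<ge> 0" using C \<phi> by (simp add: T_def C'_def)
      have tail: "(\<Sum>s\<in>S. coeff (jump_gf n ^ (k - 1)) s) \<le> T * F n ^ k"
        if "finite S" "\<And>s. s \<in> S \<Longrightarrow> d \<le> s" for S
        using markov_bound[OF C(1) C(2)[OF n(2)] _ n(1) half k that(1), folded d_def, OF _ that(2)] N(1)
        by (simp add: T_def C'_def)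
      \<comment> \<open>Telescoping over the three scales: jumps above \<open>n - d\<close>, then between \<open>x\<close> and \<open>n - d\<close>, then the rest.\<close>
      have "coeff (jump_gf n ^ k) n \<le> coeff (jump_gf (n - d) ^ k) n
          + real k * ((1 + a)\<^sup>2 * p n) * (\<Sum>s\<in>{n - n..n}. coeff (jump_gf n ^ (k - 1)) s)"
        using elim(2) by (intro jumps_between_upper) (auto simp: d_def)
      also have "\<dots> \<le> coeff (jump_gf (n - d) ^ k) n + real k * ((1 + a)\<^sup>2 * p n) * ((1 + a) * F n ^ k)"
      proof (intro add_left_mono mult_left_mono)
        show "(\<Sum>s\<in>{n - n..n}. coeff (jump_gf n ^ (k - 1)) s) \<le> (1 + a) * F n ^ k"
          using sum_coeff_jump_gf_power_le[of "{n - n..n}" n "k - 1"] F_power_pred_le[OF elim(5) k] a by simp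
      qed auto
      also have "real k * ((1 + a)\<^sup>2 * p n) * ((1 + a) * F n ^ k) = (1 + a) ^ 3 * B"
        by (simp add: B_def power3_eq_cube power2_eq_square)
      also have "(1 + a) ^ 3 * B \<le> (1 + \<eta> / 2) * B"
      proof (intro mult_right_mono B)
        have sq: "a * a \<le> a" using mult_left_le[of a a] a by simp
        have "a * (a * a) \<le> a" using a sq by (intro mult_left_le) linarith+
        moreover have "(1 + a) ^ 3 = 1 + 3 * a + 3 * (a * a) + a * (a * a)"
          by (simp add: power3_eq_cube algebra_simps)
        ultimately show "(1 + a) ^ 3 \<le> 1 + \<eta> / 2" using a sq by linarith
      qed
      also have "coeff (jump_gf (n - d) ^ k) n \<le> coeff (jump_gf x ^ k) n
          + real k * (2 * 4 ^ Suc I * p n) * (\<Sum>s\<in>{n - (n - d)..n}. coeff (jump_gf (n - d) ^ (k - 1)) s)"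
      proof (rule jumps_between_upper)
        fix j assume "x < j" "j \<le> n - d"
        then show "p j \<le> 2 * 4 ^ Suc I * p n"
          using y(2)[of j n "Suc I"] elim(3) unfolding x_def by linarith
      qed (use dx in auto)
      also have "\<dots> \<le> \<eta> / 2 * B + real k * (2 * 4 ^ Suc I * p n) * (T * F n ^ k)"
      proof (intro add_mono mult_left_mono)
        have "coeff (jump_gf x ^ k) n \<le> coeff (jump_gf (n div 2 ^ I) ^ k) n"
          unfolding x_def by (intro coeff_jump_gf_power_mono div_le_mono2) auto
        also have "\<dots> \<le> \<eta> / 2 * B" using elim(1) k by (simp add: B_def mult_ac)
        finally show "coeff (jump_gf x ^ k) n \<le> \<eta> / 2 * B" .
        have "(\<Sum>s\<in>{n - (n - d)..n}. coeff (jump_gf (n - d) ^ (k - 1)) s)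
            \<le> (\<Sum>s\<in>{n - (n - d)..n}. coeff (jump_gf n ^ (k - 1)) s)"
          by (intro sum_mono coeff_jump_gf_power_mono) auto
        also have "\<dots> \<le> T * F n ^ k" using dx by (intro tail) auto
        finally show "(\<Sum>s\<in>{n - (n - d)..n}. coeff (jump_gf (n - d) ^ (k - 1)) s) \<le> T * F n ^ k" .
      qed auto
      also have "real k * (2 * 4 ^ Suc I * p n) * (T * F n ^ k) = 2 * 4 ^ Suc I * T * B"
        by (simp add: B_def)
      finally have upper: "coeff (jump_gf n ^ k) n - B \<le> (\<eta> + 2 * 4 ^ Suc I * T) * B"
        by (simp add: algebra_simps)
      \<comment> \<open>One jump above \<open>n - d\<close> leaves less than \<open>d \<le> n - d\<close> for the other steps, so that
        truncating these at \<open>n - d\<close> instead of \<open>n\<close> has no effect.\<close>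
      have "F n ^ k \<le> F n ^ (k - 1)" using F_le_1 by (intro power_decreasing) auto
      also have "\<dots> = poly (jump_gf n ^ (k - 1)) 1"
        by (simp add: poly_jump_gf_1)
      also have "\<dots> = (\<Sum>s\<le>degree (jump_gf n ^ (k - 1)). coeff (jump_gf n ^ (k - 1)) s)"
        by (simp only: poly_altdef power_one mult_1_right)
      also have "\<dots> \<le> (\<Sum>s\<in>{..<d} \<union> {d..d + degree (jump_gf n ^ (k - 1))}. coeff (jump_gf n ^ (k - 1)) s)"
        by (intro sum_mono2) auto
      also have "\<dots> = (\<Sum>s<d. coeff (jump_gf n ^ (k - 1)) s)
          + (\<Sum>s\<in>{d..d + degree (jump_gf n ^ (k - 1))}. coeff (jump_gf n ^ (k - 1)) s)"
        by (intro sum.union_disjoint) auto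
      also have "\<dots> \<le> (\<Sum>s<d. coeff (jump_gf n ^ (k - 1)) s) + T * F n ^ k"
        by (intro add_left_mono tail) auto
      also have "(\<Sum>s<d. coeff (jump_gf n ^ (k - 1)) s) = (\<Sum>s<d. coeff (jump_gf (n - d) ^ (k - 1)) s)"
        using dx by (intro sum.cong coeff_jump_gf_power_eq) auto
      finally have "(1 - T) * F n ^ k \<le> (\<Sum>s<n - (n - d). coeff (jump_gf (n - d) ^ (k - 1)) s)"
        using dx(4) by (simp add: algebra_simps)
      then have "real k * ((1 - a) * p n) * ((1 - T) * F n ^ k)
          \<le> real k * ((1 - a) * p n) * (\<Sum>s<n - (n - d). coeff (jump_gf (n - d) ^ (k - 1)) s)"
        using a by (intro mult_left_mono) auto
      also have "\<dots> \<le> coeff (jump_gf n ^ k) n"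
        using elim(2) by (intro jumps_between_lower) (auto simp: d_def)
      also have "real k * ((1 - a) * p n) * ((1 - T) * F n ^ k) = ((1 - a) * (1 - T)) * B"
        by (simp add: B_def)
      finally have "((1 - a) * (1 - T)) * B \<le> coeff (jump_gf n ^ k) n" .
      moreover have "(1 - \<eta> - 2 * 4 ^ Suc I * T) * B \<le> ((1 - a) * (1 - T)) * B"
      proof (intro mult_right_mono B)
        have "(1 :: real) \<le> 4 ^ I" by simp
        then have "1 * T \<le> 2 * 4 ^ Suc I * T" using T unfolding power_Suc by (intro mult_right_mono) linarith+
        moreover have "a * T \<ge> 0" using a T by simp
        ultimately show "1 - \<eta> - 2 * 4 ^ Suc I * T \<le> (1 - a) * (1 - T)"
          using a by (simp add: algebra_simps)
      qed
      ultimately have lower: "B - coeff (jump_gf n ^ k) n \<le> (\<eta> + 2 * 4 ^ Suc I * T) * B"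
        by (simp add: algebra_simps)
      have "\<bar>coeff (jump_gf n ^ k) n - B\<bar> \<le> (\<eta> + 2 * 4 ^ Suc I * T) * B"
        using upper lower by (intro abs_leI) auto
      then show "\<bar>coeff (jump_gf n ^ k) n - real k * p n * F n ^ k\<bar>
          \<le> (\<eta> + 2 * 4 ^ Suc I * C' * (real k * \<phi> n)) * (real k * p n * F n ^ k)"
        by (simp add: B_def T_def mult_ac)
    qed
  qed
  then show thesis by (rule that)
qed

end

section \<open>Laws of random walks on the extended naturals\<close>

lemma (in prob_space) prob_sum_eq_convolution:
  fixes X Y :: "'a \<Rightarrow> enat"
  assumes "indep_var (count_space UNIV) X (count_space UNIV) Y"
  shows "\<P>(\<omega> in M. X \<omega> + Y \<omega> = enat n)
    = (\<Sum>j\<le>n. \<P>(\<omega> in M. X \<omega> = enat j) * \<P>(\<omega> in M. Y \<omega> = enat (n - j)))"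
proof -
  have [measurable]: "X \<in> M \<rightarrow>\<^sub>M count_space UNIV" "Y \<in> M \<rightarrow>\<^sub>M count_space UNIV"
    using assms by (auto dest: indep_var_rv1 indep_var_rv2)
  have "{\<omega>\<in>space M. X \<omega> + Y \<omega> = enat n} = (\<Union>j\<le>n. {\<omega>\<in>space M. X \<omega> = enat j \<and> Y \<omega> = enat (n - j)})"
  proof (intro equalityI subsetI)
    fix \<omega> assume "\<omega> \<in> {\<omega>\<in>space M. X \<omega> + Y \<omega> = enat n}"
    then show "\<omega> \<in> (\<Union>j\<le>n. {\<omega>\<in>space M. X \<omega> = enat j \<and> Y \<omega> = enat (n - j)})"
      by (cases "X \<omega>"; cases "Y \<omega>") auto
  qed auto
  then have "\<P>(\<omega> in M. X \<omega> + Y \<omega> = enat n) = (\<Sum>j\<le>n. \<P>(\<omega> in M. X \<omega> = enat j \<and> Y \<omega> = enat (n - j)))"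
    by (simp only:) (intro finite_measure_finite_Union, auto simp: disjoint_family_on_def)
  also have "\<dots> = (\<Sum>j\<le>n. \<P>(\<omega> in M. X \<omega> = enat j) * \<P>(\<omega> in M. Y \<omega> = enat (n - j)))"
  proof (intro sum.cong refl)
    fix j
    have "\<P>(\<omega> in M. X \<omega> \<in> {enat j} \<and> Y \<omega> \<in> {enat (n - j)}) = \<P>(\<omega> in M. X \<omega> \<in> {enat j}) * \<P>(\<omega> in M. Y \<omega> \<in> {enat (n - j)})"
      using indep_varD[OF assms, of "{enat j}" "{enat (n - j)}"] by (simp add: vimage_def Int_def conj_commute)
    then show "\<P>(\<omega> in M. X \<omega> = enat j \<and> Y \<omega> = enat (n - j)) = \<P>(\<omega> in M. X \<omega> = enat j) * \<P>(\<omega> in M. Y \<omega> = enat (n - j))"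
      by simp
  qed
  finally show ?thesis .
qed

lemma measurable_sum_enat [measurable]:
  fixes f :: "'i \<Rightarrow> 'a \<Rightarrow> enat"
  assumes "\<And>i. i \<in> I \<Longrightarrow> f i \<in> N \<rightarrow>\<^sub>M count_space UNIV"
  shows "(\<lambda>x. \<Sum>i\<in>I. f i x) \<in> N \<rightarrow>\<^sub>M count_space UNIV"
  using assms
proof (induction I rule: infinite_finite_induct)
  case (insert i I)
  then have [measurable]: "f i \<in> N \<rightarrow>\<^sub>M count_space UNIV" "(\<lambda>x. \<Sum>i\<in>I. f i x) \<in> N \<rightarrow>\<^sub>M count_space UNIV"
    by auto
  have "(\<lambda>x. (\<lambda>(a, b). a + b) (f i x, \<Sum>i\<in>I. f i x)) \<in> N \<rightarrow>\<^sub>M count_space UNIV"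
    by (rule measurable_compose[of _ _ "count_space UNIV"])
       (simp_all add: pair_measure_countable[symmetric])
  then show ?case using insert by simp
qed auto

lemma (in prob_space) indep_var_sum_enat:
  fixes X :: "nat \<Rightarrow> 'a \<Rightarrow> enat"
  assumes "indep_vars (\<lambda>_. count_space UNIV) X UNIV"
  shows "indep_var (count_space UNIV) (\<lambda>\<omega>. \<Sum>i<k. X i \<omega>) (count_space UNIV) (X k)"
proof -
  have ind: "indep_vars (\<lambda>_. count_space UNIV) X (insert k {..<k})"
    using assms by (rule indep_vars_subset) auto
  have "indep_var
    (count_space UNIV) ((\<lambda>f. \<Sum>i<k. f i) \<circ> (\<lambda>\<omega>. restrict (\<lambda>i. X i \<omega>) {..<k}))
    (count_space UNIV) ((\<lambda>f. f k) \<circ> (\<lambda>\<omega>. restrict (\<lambda>i. X i \<omega>) {k}))"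
    by (intro indep_var_compose[OF indep_var_restrict[OF ind]]) auto
  also have "((\<lambda>f. \<Sum>i<k. f i) \<circ> (\<lambda>\<omega>. restrict (\<lambda>i. X i \<omega>) {..<k})) = (\<lambda>\<omega>. \<Sum>i<k. X i \<omega>)"
    by (auto simp: fun_eq_iff)
  also have "((\<lambda>f. f k) \<circ> (\<lambda>\<omega>. restrict (\<lambda>i. X i \<omega>) {k})) = X k"
    by (auto simp: fun_eq_iff)
  finally show ?thesis .
qed

text \<open>
  Only the law of the steps up to \<open>N\<close> matters for reaching a point up to \<open>N\<close>, since the steps
  are nonnegative; hence polynomials suffice as generating functions.
\<close>

lemma (in prob_space) prob_random_walk_eq_coeff:
  fixes X :: "nat \<Rightarrow> 'a \<Rightarrow> enat"
  assumes ind: "indep_vars (\<lambda>_. count_space UNIV) X UNIV"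
    and A: "\<And>i m. m \<le> N \<Longrightarrow> \<P>(\<omega> in M. X i \<omega> = enat m) = coeff A m"
    and "n \<le> N"
  shows "\<P>(\<omega> in M. (\<Sum>i<k. X i \<omega>) = enat n) = coeff (A ^ k) n"
  using \<open>n \<le> N\<close>
proof (induction k arbitrary: n)
  case 0
  then show ?case by (simp add: zero_enat_def prob_space)
next
  case (Suc k)
  have "\<P>(\<omega> in M. (\<Sum>i<Suc k. X i \<omega>) = enat n)
      = (\<Sum>j\<le>n. \<P>(\<omega> in M. (\<Sum>i<k. X i \<omega>) = enat j) * \<P>(\<omega> in M. X k \<omega> = enat (n - j)))"
    using prob_sum_eq_convolution[OF indep_var_sum_enat[OF ind], of k n] by simp
  also have "\<dots> = (\<Sum>j\<le>n. coeff (A ^ k) j * coeff A (n - j))"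
    using Suc by (intro sum.cong) (auto simp: A)
  also have "\<dots> = coeff (A ^ Suc k) n"
    by (simp add: coeff_mult mult.commute[of A])
  finally show ?case .
qed

lemma (in prob_space) prob_finite_sums:
  fixes X :: "'a \<Rightarrow> enat"
  assumes [measurable]: "X \<in> M \<rightarrow>\<^sub>M count_space UNIV"
  shows "(\<lambda>n. \<P>(\<omega> in M. X \<omega> = enat n)) sums \<P>(\<omega> in M. X \<omega> < \<infinity>)"
proof -
  have "(\<lambda>n. \<P>(\<omega> in M. X \<omega> = enat n)) sums prob (\<Union>n. {\<omega>\<in>space M. X \<omega> = enat n})"
    by (intro finite_measure_UNION) (auto simp: disjoint_family_on_def)
  also have "(\<Union>n. {\<omega>\<in>space M. X \<omega> = enat n}) = {\<omega>\<in>space M. X \<omega> < \<infinity>}"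
    by (auto simp: less_infinityE)
  finally show ?thesis .
qed

lemma (in prob_space) prob_le_eq_sum:
  fixes X :: "'a \<Rightarrow> enat"
  assumes [measurable]: "X \<in> M \<rightarrow>\<^sub>M count_space UNIV"
  shows "1 - \<P>(\<omega> in M. X \<omega> > enat n) = (\<Sum>m\<le>n. \<P>(\<omega> in M. X \<omega> = enat m))"
proof -
  have "1 - \<P>(\<omega> in M. X \<omega> > enat n) = \<P>(\<omega> in M. \<not> X \<omega> > enat n)"
    by (subst prob_neg) auto
  also have "{\<omega>\<in>space M. \<not> X \<omega> > enat n} = (\<Union>m\<le>n. {\<omega>\<in>space M. X \<omega> = enat m})"
    using enat_ile by (fastforce simp: not_less)
  also have "prob \<dots> = (\<Sum>m\<le>n. \<P>(\<omega> in M. X \<omega> = enat m))"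
    by (intro finite_measure_finite_Union) (auto simp: disjoint_family_on_def)
  finally show ?thesis .
qed

section \<open>Local limit theorem for the renewal process\<close>

theorem theorem1p1:
  fixes M :: "'a measure" and \<tau> :: "nat \<Rightarrow> 'a \<Rightarrow> enat" and \<phi> :: "nat \<Rightarrow> real"
  assumes "renewal_process M \<tau>"
    and "recurrent M \<tau>"
    and "\<And>n. n \<ge> 1 \<Longrightarrow> \<phi> n > 0"
    and "slowly_varying (\<lambda>x. \<phi> (nat \<lfloor>x\<rfloor>))"
    and "\<And>n. n \<ge> 1 \<Longrightarrow> \<P>(\<omega> in M. \<tau> 1 \<omega> = enat n) = \<phi> n / real n"
  shows "(\<forall>k :: nat \<Rightarrow> nat. (\<forall>n. k n \<ge> 1) \<longrightarrow> (\<lambda>n. real (k n) * \<phi> n) \<longlonglongrightarrow> 0 \<longrightarrow>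
            (\<lambda>n. \<P>(\<omega> in M. \<tau> (k n) \<omega> = enat n) /
                 (real (k n) * \<P>(\<omega> in M. \<tau> 1 \<omega> = enat n) * (1 - renewal_tail M \<tau> n) ^ k n))
              \<longlonglongrightarrow> 1) \<and>
         (\<exists>c\<^sub>1>0. \<forall>\<^sub>F n in sequentially. \<forall>k. 1 \<le> k \<and> k \<le> n \<longrightarrow>
            \<P>(\<omega> in M. \<tau> k \<omega> = enat n)
              \<le> c\<^sub>1 * real k * \<P>(\<omega> in M. \<tau> 1 \<omega> = enat n) * (1 - renewal_tail M \<tau> n) ^ k)"
proof -
  from assms(1) obtain \<xi> :: "nat \<Rightarrow> 'a \<Rightarrow> enat" where "prob_space M"
    and ind: "prob_space.indep_vars M (\<lambda>_. count_space UNIV) \<xi> UNIV"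
    and distr: "\<And>i. distr M (count_space UNIV) (\<xi> i) = distr M (count_space UNIV) (\<xi> 0)"
    and ge1: "\<And>i \<omega>. \<omega> \<in> space M \<Longrightarrow> \<xi> i \<omega> \<ge> 1"
    and \<tau>: "\<And>k \<omega>. \<omega> \<in> space M \<Longrightarrow> \<tau> k \<omega> = (\<Sum>i<k. \<xi> i \<omega>)"
    unfolding renewal_process_def by auto
  interpret prob_space M by fact
  have meas [measurable]: "\<xi> i \<in> M \<rightarrow>\<^sub>M count_space UNIV" for i
    using ind by (simp add: indep_vars_def)
  have \<tau>_event: "{\<omega>\<in>space M. P (\<tau> k \<omega>)} = {\<omega>\<in>space M. P (\<Sum>i<k. \<xi> i \<omega>)}" for k P
    by (intro Collect_cong conj_cong refl) (simp only: \<tau>)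
  have \<tau>1_event: "{\<omega>\<in>space M. P (\<tau> 1 \<omega>)} = {\<omega>\<in>space M. P (\<xi> 0 \<omega>)}" for P
    unfolding \<tau>_event by simp
  have same_law: "\<P>(\<omega> in M. \<xi> i \<omega> = enat m) = \<P>(\<omega> in M. \<tau> 1 \<omega> = enat m)" for i m
  proof -
    have "measure (distr M (count_space UNIV) (\<xi> i)) {enat m} = measure (distr M (count_space UNIV) (\<xi> 0)) {enat m}"
      unfolding distr[of i] ..
    then show ?thesis
      unfolding \<tau>1_event[of "\<lambda>x. x = enat m"] by (simp add: measure_distr vimage_def Int_def conj_commute)
  qed
  have law: "\<P>(\<omega> in M. \<tau> 1 \<omega> = enat m) = \<phi> m / real m" for m
  proof (cases "m = 0")
    case True
    have null: "{\<omega>\<in>space M. \<xi> 0 \<omega> = enat 0} = {}" using ge1[of _ 0] by (force simp: zero_enat_def[symmetric])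
    show ?thesis unfolding True \<tau>1_event[of "\<lambda>x. x = enat 0"] null by simp
  qed (use assms(5) in simp)
  have total: "(\<lambda>n. \<phi> n / real n) sums 1"
  proof -
    have "(\<lambda>n. \<P>(\<omega> in M. \<xi> 0 \<omega> = enat n)) sums \<P>(\<omega> in M. \<xi> 0 \<omega> < \<infinity>)"
      by (intro prob_finite_sums meas)
    also have "\<P>(\<omega> in M. \<xi> 0 \<omega> < \<infinity>) = \<P>(\<omega> in M. \<tau> 1 \<omega> < \<infinity>)"
      unfolding \<tau>1_event[of "\<lambda>x. x < \<infinity>"] ..
    also have "\<dots> = 1" using assms(2) by (simp add: recurrent_def)
    finally show ?thesis by (simp only: same_law law)
  qed
  interpret slowly_varying_jumps \<phi>
    using assms(3,4) total by unfold_locales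
  have tail: "1 - renewal_tail M \<tau> n = F n" for n
  proof -
    have "renewal_tail M \<tau> n = \<P>(\<omega> in M. \<xi> 0 \<omega> > enat n)"
      unfolding renewal_tail_def \<tau>1_event[of "\<lambda>x. x > enat n"] ..
    then show ?thesis
      using prob_le_eq_sum[OF meas, of n 0] by (simp only: same_law law F_def p_def)
  qed
  have prob: "\<P>(\<omega> in M. \<tau> k \<omega> = enat n) = coeff (jump_gf n ^ k) n" for k n
  proof -
    have "\<P>(\<omega> in M. \<tau> k \<omega> = enat n) = \<P>(\<omega> in M. (\<Sum>i<k. \<xi> i \<omega>) = enat n)"
      unfolding \<tau>_event[of "\<lambda>x. x = enat n"] ..
    also have "\<dots> = coeff (jump_gf n ^ k) n"
      by (intro prob_random_walk_eq_coeff[where N=n] ind)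
         (simp_all only: same_law law coeff_jump_gf p_def if_True order_refl)
    finally show ?thesis .
  qed
  have law_p: "\<P>(\<omega> in M. \<tau> 1 \<omega> = enat n) = p n" for n by (simp only: law p_def)
  show ?thesis
    unfolding tail law_p unfolding prob
  proof (intro conjI allI impI)
    fix k :: "nat \<Rightarrow> nat"
    assume k: "\<forall>n. k n \<ge> 1" and k\<phi>: "(\<lambda>n. real (k n) * \<phi> n) \<longlonglongrightarrow> 0"
    show "(\<lambda>n. coeff (jump_gf n ^ k n) n / (real (k n) * p n * F n ^ k n)) \<longlonglongrightarrow> 1"
    proof (rule tendstoI)
      fix e :: real assume e: "e > 0"
      obtain C where C: "\<forall>\<^sub>F n in sequentially. \<forall>k\<ge>1.
        \<bar>coeff (jump_gf n ^ k) n - real k * p n * F n ^ k\<bar>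
          \<le> (e / 2 + C * (real k * \<phi> n)) * (real k * p n * F n ^ k)"
        using local_asymptotics[of "e / 2"] e by auto
      have "(\<lambda>n. C * (real (k n) * \<phi> n)) \<longlonglongrightarrow> C * 0" by (intro tendsto_intros k\<phi>)
      then have "\<forall>\<^sub>F n in sequentially. C * (real (k n) * \<phi> n) < e / 2"
        using e by (intro order_tendstoD) auto
      with C show "\<forall>\<^sub>F n in sequentially.
          dist (coeff (jump_gf n ^ k n) n / (real (k n) * p n * F n ^ k n)) 1 < e"
        using eventually_ge_at_top[of 1]
      proof eventually_elim
        case (elim n)
        define B where "B = real (k n) * p n * F n ^ k n"
        have B: "B > 0" using p_pos[OF elim(3)] F_pos[OF elim(3)] k[rule_format, of n] by (simp add: B_def)
        have quot: "coeff (jump_gf n ^ k n) n / B - 1 = (coeff (jump_gf n ^ k n) n - B) / B"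
          using B by (simp add: diff_divide_distrib)
        have "dist (coeff (jump_gf n ^ k n) n / B) 1 = \<bar>coeff (jump_gf n ^ k n) n - B\<bar> / B"
          unfolding dist_real_def quot abs_divide using B by simp
        also have "\<dots> \<le> e / 2 + C * (real (k n) * \<phi> n)"
          using elim(1)[rule_format, of "k n"] k B unfolding B_def[symmetric] by (simp add: pos_divide_le_eq)
        also have "\<dots> < e" using elim(2) by simp
        finally show ?case by (simp add: B_def)
      qed
    qed
  next
    show "\<exists>c\<^sub>1>0. \<forall>\<^sub>F n in sequentially. \<forall>k. 1 \<le> k \<and> k \<le> n \<longrightarrow>
        coeff (jump_gf n ^ k) n \<le> c\<^sub>1 * real k * p n * F n ^ k"
      using uniform_local_bound by (auto elim!: eventually_mono)
  qed
qed

end
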